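(* Let $E=\{0,1,\dots,n\}$ and let $c_1,\dots,c_n$ be nonnegative integers with $c_1+\dots+c_n=r$. Then the function on matroids of rank $r+1$ on $E$ given by $M\mapsto\deg_M(\gamma_1^{c_1}\cdots\gamma_n^{c_n})$ is valuative.
   Context: For a loopless matroid $M$ of rank $r+1$ on $E$, the Chow ring $A^*(M)$ (real coefficients) is $\mathbb{R}[x_F : F \text{ a nonempty proper flat of } M]$ modulo the ideal generated by all $x_{F_1}x_{F_2}$ with $F_1,F_2$ incomparable and all $\sum_{F\ni i}x_F-\sum_{F\ni j}x_F$ for $i,j\in E$; $\deg_M:A^r(M)\to\mathbb{R}$ is the linear map with value $1$ on $x_{F_1}\cdots x_{F_r}$ for each complete flag of flats $\varnothing\subsetneq F_1\subsetneq\cdots\subsetneq F_r\subsetneq E$. For $S\subseteq E$, $x_S$ means the generator if $S$ is a nonempty proper flat and $0$ otherwise. Hypersimplex classes: $\gamma_k=\sum_S\left(\min(|S|,k)-\frac{k}{n+1}|S|\right)x_S$ (sum over nonempty proper $S\subsetneq E$). For a matroid with loops the Chow ring is zero and the value of the function is $0$. The matroid polytope of $M$ is $P(M)=\mathrm{Conv}\{e_B : B \text{ a basis of } M\}\subseteq\mathbb{R}^E$, where $e_B=\sum_{i\in B}e_i$, and $1_{P(M)}$ is its indicator function. A function $\phi$ from matroids to an abelian group is valuative if whenever $M_1,\dots,M_m$ are matroids on $E$ and $a_1,\dots,a_m$ integers with $\sum_i a_i1_{P(M_i)}=0$, one has $\sum_i a_i\phi(M_i)=0$. *)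

theory Defs
  imports
    "HOL-Analysis.Analysis"
    "HOL-Library.Function_Algebras"
    "HOL-Library.Poly_Mapping"
    "HOL-Algebra.QuotRing"
begin

section \<open>Matroids\<close>

text \<open>A matroid on \<open>E\<close> is represented by its set of bases.\<close>

definition matroid :: "'a set \<Rightarrow> 'a set set \<Rightarrow> bool" where
  "matroid E M \<longleftrightarrow> finite E \<and> M \<noteq> {} \<and> (\<forall>B\<in>M. B \<subseteq> E) \<and>
     (\<forall>B1\<in>M. \<forall>B2\<in>M. \<forall>x\<in>B1 - B2. \<exists>y\<in>B2 - B1. insert y (B1 - {x}) \<in> M)"

definition mrank :: "'a set set \<Rightarrow> 'a set \<Rightarrow> nat" where
  "mrank M S = Max ((\<lambda>B. card (S \<inter> B)) ` M)"

definition loopless :: "'a set \<Rightarrow> 'a set set \<Rightarrow> bool" where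
  "loopless E M \<longleftrightarrow> (\<forall>i\<in>E. mrank M {i} = 1)"

definition flat :: "'a set \<Rightarrow> 'a set set \<Rightarrow> 'a set \<Rightarrow> bool" where
  "flat E M F \<longleftrightarrow> F \<subseteq> E \<and> (\<forall>i\<in>E - F. mrank M (insert i F) > mrank M F)"

definition proper_flats :: "'a set \<Rightarrow> 'a set set \<Rightarrow> 'a set set" where
  "proper_flats E M = {F. flat E M F \<and> F \<noteq> {} \<and> F \<noteq> E}"

section \<open>Matroid polytopes and valuativity\<close>

instantiation "fun" :: (type, real_vector) real_vector
begin

definition scaleR_fun :: "real \<Rightarrow> ('a \<Rightarrow> 'b) \<Rightarrow> 'a \<Rightarrow> 'b" where
  "scaleR_fun c f = (\<lambda>x. c *\<^sub>R f x)"

instance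
  by standard (simp_all add: scaleR_fun_def plus_fun_def fun_eq_iff scaleR_add_right scaleR_add_left)

end

text \<open>
  The space \<open>\<real>\<^sup>E\<close> is identified with the functions vanishing outside \<open>E\<close>;
  \<open>e\<^sub>B\<close> is then \<open>indicator B\<close>.
\<close>

definition matroid_polytope :: "'a set set \<Rightarrow> ('a \<Rightarrow> real) set" where
  "matroid_polytope M = convex hull ((\<lambda>B. indicator B) ` M)"

definition valuative_on :: "'a set set set \<Rightarrow> ('a set set \<Rightarrow> real) \<Rightarrow> bool" where
  "valuative_on \<M> \<phi> \<longleftrightarrow>
     (\<forall>(m::nat) (M :: nat \<Rightarrow> 'a set set) (a :: nat \<Rightarrow> int).
        (\<forall>i\<in>{1..m}. M i \<in> \<M>) \<and>
        (\<forall>x. (\<Sum>i=1..m. a i * indicator (matroid_polytope (M i)) x) = 0)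
        \<longrightarrow> (\<Sum>i=1..m. of_int (a i) * \<phi> (M i)) = 0)"

section \<open>Polynomial rings\<close>

text \<open>Monomials are finitely supported exponent functions on the variables.\<close>

type_synonym 'v rpoly = "('v \<Rightarrow>\<^sub>0 nat) \<Rightarrow>\<^sub>0 real"

definition poly_var :: "'v \<Rightarrow> 'v rpoly" where
  "poly_var v = Poly_Mapping.single (Poly_Mapping.single v 1) 1"

definition poly_const :: "real \<Rightarrow> 'v rpoly" where
  "poly_const c = Poly_Mapping.single 0 c"

definition polynomial_ring :: "'v set \<Rightarrow> 'v rpoly ring" where
  "polynomial_ring V =
     \<lparr>carrier = {p. \<forall>m\<in>Poly_Mapping.keys p. Poly_Mapping.keys m \<subseteq> V},
      mult = (*), one = 1, zero = 0, add = (+)\<rparr>"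

definition homogeneous :: "nat \<Rightarrow> 'v rpoly \<Rightarrow> bool" where
  "homogeneous d p \<longleftrightarrow>
     (\<forall>m\<in>Poly_Mapping.keys p. (\<Sum>v\<in>Poly_Mapping.keys m. Poly_Mapping.lookup m v) = d)"

lemma cring_polynomial_ring: "cring (polynomial_ring V)"
proof -
  let ?C = "carrier (polynomial_ring V)"
  have plus: "p + q \<in> ?C" if "p \<in> ?C" "q \<in> ?C" for p q
    using that Poly_Mapping.keys_add[of p q] by (auto simp: polynomial_ring_def)
  have uminus: "- p \<in> ?C" if "p \<in> ?C" for p
    using that by (auto simp: polynomial_ring_def in_keys_iff)
  have times: "p * q \<in> ?C" if p: "p \<in> ?C" and q: "q \<in> ?C" for p q
  proof -
    have "Poly_Mapping.keys m \<subseteq> V" if m: "m \<in> Poly_Mapping.keys (p * q)" for m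
    proof -
      obtain a b where ab: "a \<in> Poly_Mapping.keys p" "b \<in> Poly_Mapping.keys q" "m = a + b"
        using m Poly_Mapping.keys_mult[of p q] by blast
      then have "Poly_Mapping.keys a \<subseteq> V" "Poly_Mapping.keys b \<subseteq> V"
        using p q by (auto simp: polynomial_ring_def)
      then show ?thesis
        using Poly_Mapping.keys_add[of a b] ab by blast
    qed
    then show ?thesis
      by (auto simp: polynomial_ring_def)
  qed
  have ops: "mult (polynomial_ring V) = (*)" "one (polynomial_ring V) = 1"
    "zero (polynomial_ring V) = 0" "add (polynomial_ring V) = (+)"
    by (simp_all add: polynomial_ring_def)
  have zero: "0 \<in> ?C" and one: "1 \<in> ?C"
    by (simp_all add: polynomial_ring_def)
  show ?thesis
  proof (rule cringI)
    show "abelian_group (polynomial_ring V)"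
      unfolding abelian_group_def abelian_group_axioms_def
    proof (intro conjI)
      show "abelian_monoid (polynomial_ring V)"
        by (rule abelian_monoidI) (auto simp: ops zero add.assoc add.commute intro: plus)
      show "comm_group (add_monoid (polynomial_ring V))"
        by (rule comm_groupI)
          (auto simp: ops zero add.assoc add.commute intro: plus bexI[OF _ uminus])
    qed
    show "comm_monoid (polynomial_ring V)"
      by (rule comm_monoidI) (auto simp: ops one mult.assoc mult.commute intro: times)
  qed (simp add: ops distrib_right)
qed

section \<open>The Chow ring of a loopless matroid\<close>

definition chow_relations :: "'a set \<Rightarrow> 'a set set \<Rightarrow> 'a set rpoly set" where
  "chow_relations E M =
     {poly_var F1 * poly_var F2 | F1 F2.
        F1 \<in> proper_flats E M \<and> F2 \<in> proper_flats E M \<and> \<not> F1 \<subseteq> F2 \<and> \<not> F2 \<subseteq> F1} \<union>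
     {(\<Sum>F | F \<in> proper_flats E M \<and> i \<in> F. poly_var F) -
      (\<Sum>F | F \<in> proper_flats E M \<and> j \<in> F. poly_var F) | i j. i \<in> E \<and> j \<in> E}"

definition chow_ideal :: "'a set \<Rightarrow> 'a set set \<Rightarrow> 'a set rpoly set" where
  "chow_ideal E M = genideal (polynomial_ring (proper_flats E M)) (chow_relations E M)"

definition chow_ring :: "'a set \<Rightarrow> 'a set set \<Rightarrow> 'a set rpoly set ring" where
  "chow_ring E M = polynomial_ring (proper_flats E M) Quot chow_ideal E M"

definition chow_class :: "'a set \<Rightarrow> 'a set set \<Rightarrow> 'a set rpoly \<Rightarrow> 'a set rpoly set" where
  "chow_class E M p = chow_ideal E M +>\<^bsub>polynomial_ring (proper_flats E M)\<^esub> p"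

definition chow_graded :: "'a set \<Rightarrow> 'a set set \<Rightarrow> nat \<Rightarrow> 'a set rpoly set set" where
  "chow_graded E M d =
     chow_class E M ` {p \<in> carrier (polynomial_ring (proper_flats E M)). homogeneous d p}"

definition chow_smult ::
    "'a set \<Rightarrow> 'a set set \<Rightarrow> real \<Rightarrow> 'a set rpoly set \<Rightarrow> 'a set rpoly set" where
  "chow_smult E M t a = chow_class E M (poly_const t) \<otimes>\<^bsub>chow_ring E M\<^esub> a"

definition chow_x :: "'a set \<Rightarrow> 'a set set \<Rightarrow> 'a set \<Rightarrow> 'a set rpoly set" where
  "chow_x E M S =
     (if S \<in> proper_flats E M then chow_class E M (poly_var S) else \<zero>\<^bsub>chow_ring E M\<^esub>)"

definition complete_flag :: "'a set \<Rightarrow> 'a set set \<Rightarrow> nat \<Rightarrow> (nat \<Rightarrow> 'a set) \<Rightarrow> bool" where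
  "complete_flag E M r F \<longleftrightarrow>
     (\<forall>i\<in>{1..r}. F i \<in> proper_flats E M) \<and> (\<forall>i\<in>{1..<r}. F i \<subset> F (Suc i))"

definition is_degree_map ::
    "'a set \<Rightarrow> 'a set set \<Rightarrow> nat \<Rightarrow> ('a set rpoly set \<Rightarrow> real) \<Rightarrow> bool" where
  "is_degree_map E M r f \<longleftrightarrow>
     (\<forall>a\<in>chow_graded E M r. \<forall>b\<in>chow_graded E M r. f (a \<oplus>\<^bsub>chow_ring E M\<^esub> b) = f a + f b) \<and>
     (\<forall>t. \<forall>a\<in>chow_graded E M r. f (chow_smult E M t a) = t * f a) \<and>
     (\<forall>F. complete_flag E M r F \<longrightarrow>
        f (finprod (chow_ring E M) (\<lambda>i. chow_x E M (F i)) {1..r}) = 1)"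

text \<open>Extensionality makes a map on the top graded piece unique as a total function.\<close>

definition chow_deg :: "'a set \<Rightarrow> 'a set set \<Rightarrow> 'a set rpoly set \<Rightarrow> real" where
  "chow_deg E M =
     (let r = mrank M E - 1 in
        THE f. f \<in> extensional (chow_graded E M r) \<and> is_degree_map E M r f)"

definition hypersimplex_class :: "'a set \<Rightarrow> 'a set set \<Rightarrow> nat \<Rightarrow> 'a set rpoly set" where
  "hypersimplex_class E M k =
     finsum (chow_ring E M)
       (\<lambda>S. chow_smult E M
          (real (min (card S) k) - real k / real (card E) * real (card S)) (chow_x E M S))
       {S. S \<noteq> {} \<and> S \<subset> E}"

end

theory Submission
  imports Defs "HOL-Library.Multiset"
begin

text \<open>
  Put \<open>x\<^sub>E = - \<Sum>\<^sub>F\<^sub>\<ni>\<^sub>i x\<^sub>F\<close> and \<open>h\<^sub>A = - \<Sum>\<^sub>S\<^sub>\<supseteq>\<^sub>A x\<^sub>S\<close>, so that by Moebius inversion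
  \<open>x\<^sub>S = - \<Sum>\<^sub>A\<^sub>\<supseteq>\<^sub>S (-1)\<^bsup>|A - S|\<^esup> h\<^sub>A\<close>. The degree of a product of \<open>h\<^sub>A\<close>, where \<open>A\<close> runs through a
  multiset \<open>C\<close> of size \<open>r\<close>, is \<open>1\<close> or \<open>0\<close> according to whether the dragon Hall-Rado condition
  \<open>rk S > #{A \<in> C. A \<subseteq> S}\<close> holds for all nonempty \<open>S \<subseteq> E\<close> (Backman, Eur, Simpson). Taking this as
  the definition of a functional on polynomials, the relations of the Chow ring follow from the
  submodularity of the rank, complete flags get the value \<open>1\<close>, and since complete flags span the top
  degree, this functional is the degree map.

  Let \<open>Q\<close> be the polyhedron \<open>{x. \<forall>S \<subseteq> E. x(S) \<ge> |S|/|E| + #{A \<in> C. A \<subseteq> S}}\<close>. By Rado's theorem the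
  condition says precisely that the matroid polytope meets \<open>Q\<close>; it is therefore the Euler
  characteristic of \<open>P(M) \<inter> Q\<close>, which is additive on indicator functions of compact convex sets.
  Hence the degree of every monomial in the \<open>x\<^sub>S\<close> is valuative, and the coefficients of the
  hypersimplex classes do not depend on the matroid.
\<close>

section \<open>Rank functions of matroids\<close>

locale finite_matroid =
  fixes E :: "'a set" and M :: "'a set set"
  assumes matroid: "matroid E M"
begin

abbreviation rk :: "'a set \<Rightarrow> nat" where "rk \<equiv> mrank M"

lemma finite_E: "finite E" and bases_nonempty: "M \<noteq> {}"
  and base_subset: "B \<in> M \<Longrightarrow> B \<subseteq> E"
  using matroid by (auto simp: matroid_def)

lemma base_exchange:
  assumes "B1 \<in> M" "B2 \<in> M" "x \<in> B1 - B2"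
  obtains y where "y \<in> B2 - B1" "insert y (B1 - {x}) \<in> M"
  using assms matroid unfolding matroid_def by metis

lemma finite_base: "B \<in> M \<Longrightarrow> finite B"
  using base_subset finite_E finite_subset by blast

lemma finite_bases: "finite M"
  by (rule finite_subset[of _ "Pow E"]) (use base_subset finite_E in auto)

text \<open>An exchange swaps an element of \<open>B1 - B2\<close> for one of
  \<open>B2 - B1\<close>. This keeps \<open>card B1\<close> and shrinks the difference, until
  \<open>B1 \<subseteq> B2\<close>.\<close>

lemma card_base_le:
  assumes "B1 \<in> M" "B2 \<in> M"
  shows "card B1 \<le> card B2"
  using assms(1)
proof (induction "card (B1 - B2)" arbitrary: B1 rule: less_induct)
  case less
  show ?case
  proof (cases "B1 \<subseteq> B2")
    case True
    then show ?thesis using assms(2) finite_base card_mono by blast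
  next
    case False
    then obtain x where x: "x \<in> B1 - B2" by blast
    then obtain y where y: "y \<in> B2 - B1" "insert y (B1 - {x}) \<in> M"
      using base_exchange less.prems assms(2) by metis
    have fin: "finite B1" using less.prems finite_base by blast
    have "card (insert y (B1 - {x}) - B2) < card (B1 - B2)"
      by (rule psubset_card_mono) (use x y fin in auto)
    then have "card (insert y (B1 - {x})) \<le> card B2" using less.hyps y by blast
    moreover have "card (insert y (B1 - {x})) = card B1"
      using x y fin card_Suc_Diff1[of B1 x] by simp
    ultimately show ?thesis by simp
  qed
qed

lemma card_base_eq: "B1 \<in> M \<Longrightarrow> B2 \<in> M \<Longrightarrow> card B1 = card B2"
  using card_base_le le_antisym by blast

text \<open>Exchanges towards \<open>B2\<close> that remove only elements outside \<open>Y\<close>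
  never lose \<open>B1 \<inter> Y\<close>. While \<open>B2\<close> meets \<open>Y\<close> in more
  elements than \<open>B1\<close>, equal cardinality of bases provides such a removable
  element.\<close>

lemma base_augment:
  assumes "B1 \<in> M" "B2 \<in> M"
  shows "\<exists>B\<in>M. B1 \<inter> Y \<subseteq> B \<and> card (B2 \<inter> Y) \<le> card (B \<inter> Y)"
  using assms(1)
proof (induction "card (B1 - B2)" arbitrary: B1 rule: less_induct)
  case less
  show ?case
  proof (cases "card (B2 \<inter> Y) \<le> card (B1 \<inter> Y)")
    case True
    then show ?thesis using less.prems by blast
  next
    case False
    have fin: "finite B1" "finite B2" using less.prems assms(2) finite_base by blast+
    have "card B1 = card (B1 \<inter> Y) + card (B1 - Y)" "card B2 = card (B2 \<inter> Y) + card (B2 - Y)"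
      using fin card_Int_Diff by (metis, metis)
    then have "card (B2 - Y) < card (B1 - Y)"
      using False card_base_eq[OF less.prems assms(2)] by linarith
    then have "\<not> B1 - Y \<subseteq> B2 - Y" using fin card_mono[of "B2 - Y" "B1 - Y"] by auto
    then obtain x where x: "x \<in> B1 - B2" "x \<notin> Y" by blast
    then obtain y where y: "y \<in> B2 - B1" "insert y (B1 - {x}) \<in> M"
      using base_exchange less.prems assms(2) by metis
    have "card (insert y (B1 - {x}) - B2) < card (B1 - B2)"
      by (rule psubset_card_mono) (use x y fin in auto)
    then obtain B where "B \<in> M" "insert y (B1 - {x}) \<inter> Y \<subseteq> B" "card (B2 \<inter> Y) \<le> card (B \<inter> Y)"
      using less.hyps y by blast
    then show ?thesis using x by blast
  qed
qed

lemma card_Int_base_le: "B \<in> M \<Longrightarrow> card (S \<inter> B) \<le> rk S"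
  unfolding mrank_def using finite_bases by simp

lemma rank_attained: "\<exists>B\<in>M. rk S = card (S \<inter> B)"
proof -
  have "Max ((\<lambda>B. card (S \<inter> B)) ` M) \<in> (\<lambda>B. card (S \<inter> B)) ` M"
    using finite_bases bases_nonempty by (intro Max_in) auto
  then show ?thesis unfolding mrank_def by auto
qed

lemma rank_mono: "S \<subseteq> T \<Longrightarrow> rk S \<le> rk T"
  using rank_attained[of S] card_Int_base_le[of _ T] finite_base
  by (metis Int_mono card_mono finite_Int order_refl order_trans)

text \<open>A base that is optimal for \<open>X\<close> is augmented inside \<open>Y\<close>; since
  \<open>X \<subseteq> Y\<close>, nothing of it in \<open>X\<close> is lost.\<close>

lemma rank_attained_nested:
  assumes "X \<subseteq> Y"
  shows "\<exists>B\<in>M. rk X = card (X \<inter> B) \<and> rk Y = card (Y \<inter> B)"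
proof -
  obtain B1 B2 where B1: "B1 \<in> M" "rk X = card (X \<inter> B1)"
    and B2: "B2 \<in> M" "rk Y = card (Y \<inter> B2)"
    using rank_attained by metis
  then obtain B where B: "B \<in> M" "B1 \<inter> Y \<subseteq> B" "card (B2 \<inter> Y) \<le> card (B \<inter> Y)"
    using base_augment by metis
  have "card (X \<inter> B1) \<le> card (X \<inter> B)"
    by (rule card_mono) (use assms B finite_base in auto)
  then show ?thesis
    using B1 B2 B card_Int_base_le[OF B(1)] by (metis Int_commute le_antisym)
qed

text \<open>One base attains the rank on both \<open>S \<inter> T\<close> and
  \<open>S \<union> T\<close>; for a fixed base the intersection size is modular and bounds the rank
  from below.\<close>

lemma rank_submodular: "rk (S \<union> T) + rk (S \<inter> T) \<le> rk S + rk T"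
proof -
  obtain B where B: "B \<in> M" "rk (S \<inter> T) = card (S \<inter> T \<inter> B)" "rk (S \<union> T) = card ((S \<union> T) \<inter> B)"
    using rank_attained_nested[of "S \<inter> T" "S \<union> T"] by blast
  have "card (S \<inter> B) + card (T \<inter> B) = card ((S \<inter> B) \<union> (T \<inter> B)) + card ((S \<inter> B) \<inter> (T \<inter> B))"
    using B finite_base by (intro card_Un_Int) auto
  moreover have "(S \<inter> B) \<union> (T \<inter> B) = (S \<union> T) \<inter> B" "(S \<inter> B) \<inter> (T \<inter> B) = S \<inter> T \<inter> B" by auto
  ultimately show ?thesis using B card_Int_base_le[OF B(1)] by (metis add_mono)
qed

lemma rank_empty [simp]: "rk {} = 0"
  using rank_attained[of "{}"] by auto

lemma rank_singleton_le: "rk {i} \<le> 1"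
proof -
  obtain B where "B \<in> M" "rk {i} = card ({i} \<inter> B)" using rank_attained by metis
  then show ?thesis using card_mono[of "{i}" "{i} \<inter> B"] by simp
qed

lemma rank_insert_eq_mono:
  assumes "S \<subseteq> T" "rk (insert i S) = rk S"
  shows "rk (insert i T) = rk T"
proof -
  have "rk (insert i S \<union> T) + rk (insert i S \<inter> T) \<le> rk (insert i S) + rk T"
    by (rule rank_submodular)
  moreover have "rk S \<le> rk (insert i S \<inter> T)" by (rule rank_mono) (use assms in auto)
  moreover have "insert i S \<union> T = insert i T" using assms by auto
  ultimately have "rk (insert i T) \<le> rk T" using assms by simp
  then show ?thesis using rank_mono[of T "insert i T"] by (simp add: le_antisym subset_insertI)
qed

lemma flat_rank_less:
  assumes "flat E M F" "F \<subset> T" "T \<subseteq> E"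
  shows "rk F < rk T"
proof -
  obtain i where i: "i \<in> T" "i \<notin> F" using assms by blast
  then have "rk F < rk (insert i F)" using assms by (auto simp: flat_def)
  also have "\<dots> \<le> rk T" using i assms by (intro rank_mono) auto
  finally show ?thesis .
qed

text \<open>Both flats are the closure of \<open>insert i S\<close>, which already has their rank.
  This singles out the one surviving flat when a flag is extended by a step.\<close>

lemma flat_eq_of_rank_Suc:
  assumes "flat E M F" "flat E M G" "insert i S \<subseteq> F" "insert i S \<subseteq> G"
    and "rk S < rk (insert i S)" "rk F = Suc (rk S)" "rk G = Suc (rk S)"
  shows "F = G"
proof -
  have *: "F' \<subseteq> G'" if F': "flat E M F'" "insert i S \<subseteq> F'" "rk F' = Suc (rk S)"
    and G': "flat E M G'" "insert i S \<subseteq> G'" for F' G'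
  proof
    fix j assume j: "j \<in> F'"
    have "rk (insert j (insert i S)) \<le> rk F'" by (rule rank_mono) (use j F' in auto)
    moreover have "rk (insert i S) \<le> rk (insert j (insert i S))" by (rule rank_mono) auto
    ultimately have "rk (insert j (insert i S)) = rk (insert i S)"
      using F'(3) assms(5) by linarith
    then have "rk (insert j G') = rk G'" using rank_insert_eq_mono G' by metis
    moreover have "j \<in> E" using j F'(1) by (auto simp: flat_def)
    ultimately show "j \<in> G'" using G'(1) unfolding flat_def by (metis DiffI less_irrefl)
  qed
  show ?thesis
    using *[OF assms(1,3,6,2,4)] *[OF assms(2,4,7,1,3)] by (rule equalityI)
qed

lemma finite_proper_flats: "finite (proper_flats E M)"
  by (rule finite_subset[of _ "Pow E"]) (auto simp: proper_flats_def flat_def finite_E)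

lemma proper_flat_rank_less: "F \<in> proper_flats E M \<Longrightarrow> rk F < rk E"
  by (rule flat_rank_less) (auto simp: proper_flats_def flat_def)

end

section \<open>The dragon Hall-Rado condition\<close>

definition subcount :: "'a set multiset \<Rightarrow> 'a set \<Rightarrow> nat" where
  "subcount C S = size (filter_mset (\<lambda>A. A \<subseteq> S) C)"

lemma subcount_empty [simp]: "subcount {#} S = 0"
  and subcount_add [simp]: "subcount (add_mset A C) S = of_bool (A \<subseteq> S) + subcount C S"
  by (auto simp: subcount_def)

lemma subcount_mono: "S \<subseteq> T \<Longrightarrow> subcount C S \<le> subcount C T"
  by (induction C) auto

lemma subcount_antimono: "A \<subseteq> B \<Longrightarrow> subcount (add_mset B C) S \<le> subcount (add_mset A C) S"
  by auto

lemma subcount_supermodular: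
  "subcount C S + subcount C T \<le> subcount C (S \<union> T) + subcount C (S \<inter> T)"
  by (induction C) auto

lemma subcount_no_sets: "{} \<notin># C \<Longrightarrow> subcount C {} = 0"
  by (induction C) auto

lemma subcount_all: "(\<And>A. A \<in># C \<Longrightarrow> A \<subseteq> S) \<Longrightarrow> subcount C S = size C"
  by (induction C) auto

lemma subcount_replicate: "subcount (replicate_mset k A) S = of_bool (A \<subseteq> S) * k"
  by (induction k) auto

definition dragon :: "'a set \<Rightarrow> 'a set set \<Rightarrow> 'a set multiset \<Rightarrow> bool" where
  "dragon E M C \<longleftrightarrow> (\<forall>S\<subseteq>E. S \<noteq> {} \<longrightarrow> subcount C S < mrank M S)"

lemma dragonD: "dragon E M C \<Longrightarrow> S \<subseteq> E \<Longrightarrow> S \<noteq> {} \<Longrightarrow> subcount C S < mrank M S"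
  by (simp add: dragon_def)

lemma dragon_mono: "dragon E M (add_mset A C) \<Longrightarrow> A \<subseteq> B \<Longrightarrow> dragon E M (add_mset B C)"
  unfolding dragon_def by (meson subcount_antimono le_less_trans)

context finite_matroid
begin

text \<open>The set \<open>{i}\<close> counts itself, while its rank is at most one. This mirrors
  \<open>h_{i} = 0\<close>, the defining equation of \<open>x_E\<close>.\<close>

lemma dragon_singleton: "i \<in> E \<Longrightarrow> \<not> dragon E M (add_mset {i} C)"
  using rank_singleton_le[of i] dragonD[of E M "add_mset {i} C" "{i}"] by auto

text \<open>The condition is tested at \<open>insert e T\<close> instead of \<open>T\<close>: the
  rank is the same because \<open>e\<close> lies in the closure of \<open>S\<close>. This is what
  makes the variables of nonflats vanish.\<close>

lemma dragon_insert_closure: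
  assumes "rk (insert e S) = rk S" "S \<subseteq> A" "e \<in> E"
  shows "dragon E M (add_mset (insert e A) C) \<longleftrightarrow> dragon E M (add_mset A C)"
proof
  assume *: "dragon E M (add_mset (insert e A) C)"
  show "dragon E M (add_mset A C)"
    unfolding dragon_def
  proof (intro allI impI)
    fix T assume T: "T \<subseteq> E" "T \<noteq> {}"
    show "subcount (add_mset A C) T < rk T"
    proof (cases "A \<subseteq> T")
      case True
      then have "subcount (add_mset A C) T \<le> subcount (add_mset (insert e A) C) (insert e T)"
        using subcount_mono[of T "insert e T" C] by (auto simp: subset_insertI2)
      also have "\<dots> < rk (insert e T)"
        by (rule dragonD[OF *]) (use T assms(3) in auto)
      also have "\<dots> = rk T"
        using rank_insert_eq_mono[OF _ assms(1), of T] assms(2) True by blast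
      finally show ?thesis .
    next
      case False
      then show ?thesis using dragonD[OF * T] by (simp split: if_splits)
    qed
  qed
qed (erule dragon_mono, blast)

text \<open>Four-term relation behind \<open>x_S x_T = 0\<close> for incomparable sets. Enlarging a
  set weakens the condition, so it remains that the two mixed conditions together imply the
  strongest one (\<open>join\<close>) and that the weakest one implies a mixed one
  (\<open>split\<close>).\<close>

lemma dragon_exchange:
  assumes "{} \<notin># C" "f \<in> A" "e \<in> B" "e \<in> E" "f \<in> E"
  shows "of_bool (dragon E M (add_mset A (add_mset B C)))
       + of_bool (dragon E M (add_mset (insert e A) (add_mset (insert f B) C)))
       = (of_bool (dragon E M (add_mset (insert e A) (add_mset B C)))
       + of_bool (dragon E M (add_mset A (add_mset (insert f B) C))) :: real)"
proof -
  let ?D = "\<lambda>A B. dragon E M (add_mset A (add_mset B C))"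
  have mono1: "?D A B \<Longrightarrow> ?D (insert e A) B" "?D A (insert f B) \<Longrightarrow> ?D (insert e A) (insert f B)"
    by (erule dragon_mono, blast)+
  have mono2: "?D A B \<Longrightarrow> ?D A (insert f B)" "?D (insert e A) B \<Longrightarrow> ?D (insert e A) (insert f B)"
    using dragon_mono[of E M B "add_mset A C" "insert f B"]
      dragon_mono[of E M B "add_mset (insert e A) C" "insert f B"]
    by (auto simp: add_mset_commute)
  \<comment> \<open>If \<open>S\<close> contains only one of \<open>A\<close> and \<open>B\<close>,
    one mixed condition suffices; if it contains both, it contains \<open>e\<close> and
    \<open>f\<close>, and the enlargement changes no count.\<close>
  have join: "?D A B" if "?D (insert e A) B" "?D A (insert f B)"
    unfolding dragon_def
  proof (intro allI impI)
    fix S assume S: "S \<subseteq> E" "S \<noteq> {}"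
    have "subcount (add_mset (insert e A) (add_mset B C)) S < rk S"
      "subcount (add_mset A (add_mset (insert f B) C)) S < rk S"
      using that S dragonD by blast+
    then show "subcount (add_mset A (add_mset B C)) S < rk S"
      using assms by (auto simp: of_bool_def split: if_splits)
  qed
  have split: "?D (insert e A) B \<or> ?D A (insert f B)" if D: "?D (insert e A) (insert f B)"
  proof (rule ccontr)
    assume "\<not> ?thesis"
    then obtain S T where S: "S \<subseteq> E" "S \<noteq> {}" "rk S \<le> subcount (add_mset (insert e A) (add_mset B C)) S"
      and T: "T \<subseteq> E" "T \<noteq> {}" "rk T \<le> subcount (add_mset A (add_mset (insert f B) C)) T"
      unfolding dragon_def by (auto simp: not_less)
    have lower: "U \<subseteq> E \<Longrightarrow> U \<noteq> {} \<Longrightarrow>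
        of_bool (insert e A \<subseteq> U) + of_bool (insert f B \<subseteq> U) + subcount C U < rk U" for U
      using D unfolding dragon_def by (simp add: add.assoc)
    \<comment> \<open>The violating set \<open>S\<close> contains \<open>B\<close> but misses
      \<open>f\<close>, and \<open>T\<close> contains \<open>A\<close> but misses \<open>e\<close>.
      Then \<open>S \<union> T\<close> contains both enlarged sets, which contradicts submodularity
      by one unit.\<close>
    have S': "B \<subseteq> S" "f \<notin> S" "rk S \<le> 1 + subcount C S"
      using S(3) lower[OF S(1,2)] assms by (auto split: if_splits simp: of_bool_def)
    have T': "A \<subseteq> T" "e \<notin> T" "rk T \<le> 1 + subcount C T"
      using T(3) lower[OF T(1,2)] assms by (auto split: if_splits simp: of_bool_def)
    have "insert e A \<subseteq> S \<union> T" "insert f B \<subseteq> S \<union> T" using S' T' assms by auto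
    then have "2 + subcount C (S \<union> T) < rk (S \<union> T)"
      using lower[of "S \<union> T"] S T by simp
    moreover have "subcount C (S \<inter> T) \<le> rk (S \<inter> T)"
    proof (cases "S \<inter> T = {}")
      case True
      then show ?thesis using subcount_no_sets[OF assms(1)] by simp
    next
      case False
      have "S \<inter> T \<subseteq> E" using S(1) by blast
      then show ?thesis using lower[of "S \<inter> T"] False by linarith
    qed
    ultimately show False
      using S'(3) T'(3) rank_submodular[of S T] subcount_supermodular[of C S T] by linarith
  qed
  show ?thesis using mono1 mono2 join split by (auto simp: of_bool_def)
qed

end

subsection \<open>Flat variables as operators on functions of multisets\<close>

text \<open>A function \<open>g\<close> of multisets \<open>C\<close> stands for a linear functional on monomials in the \<open>h\<^sub>A\<close>;
  \<open>x_op E S g\<close> is the functional precomposed with multiplication by \<open>x\<^sub>S\<close>, written in the \<open>h\<^sub>A\<close>.\<close>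

definition x_op :: "'a set \<Rightarrow> 'a set \<Rightarrow> ('a set multiset \<Rightarrow> real) \<Rightarrow> 'a set multiset \<Rightarrow> real" where
  "x_op E S g C = - (\<Sum>A | S \<subseteq> A \<and> A \<subseteq> E. (-1) ^ card (A - S) * g (add_mset A C))"

text \<open>Commutation makes the fold over a multiset of variables independent of the
  order.\<close>

lemma x_op_commute: "x_op E S (x_op E T g) = x_op E T (x_op E S g)"
proof
  fix C
  have "x_op E S (x_op E T g) C =
    (\<Sum>A | S \<subseteq> A \<and> A \<subseteq> E. \<Sum>B | T \<subseteq> B \<and> B \<subseteq> E.
       (-1) ^ card (A - S) * ((-1) ^ card (B - T) * g (add_mset B (add_mset A C))))"
    by (simp add: x_op_def sum_distrib_left sum_negf)
  also have "\<dots> = (\<Sum>B | T \<subseteq> B \<and> B \<subseteq> E. \<Sum>A | S \<subseteq> A \<and> A \<subseteq> E.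
       (-1) ^ card (A - S) * ((-1) ^ card (B - T) * g (add_mset B (add_mset A C))))"
    by (rule sum.swap)
  also have "\<dots> = x_op E T (x_op E S g) C"
    by (simp add: x_op_def sum_distrib_left sum_negf add_mset_commute mult.left_commute)
  finally show "x_op E S (x_op E T g) C = x_op E T (x_op E S g) C" .
qed

text \<open>Adding a superset of the nonempty \<open>S\<close> keeps the multiset free of the empty
  set, so vanishing survives multiplication by further variables.\<close>

lemma x_op_eq_0:
  assumes "S \<noteq> {}" "{} \<notin># C" "\<And>C'. {} \<notin># C' \<Longrightarrow> g C' = 0"
  shows "x_op E S g C = 0"
proof -
  have "g (add_mset A C) = 0" if "S \<subseteq> A" for A
    by (rule assms(3)) (use that assms(1,2) in auto)
  then show ?thesis by (simp add: x_op_def)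
qed

text \<open>The supersets of \<open>S\<close> come in pairs \<open>A\<close>,
  \<open>insert e A\<close> with opposite signs; the vanishing proofs compare the two
  members.\<close>

lemma x_op_pairing:
  assumes "finite E" "e \<in> E - S"
  shows "x_op E S g C =
    - (\<Sum>A | S \<subseteq> A \<and> A \<subseteq> E - {e}. (-1) ^ card (A - S) *
         (g (add_mset A C) - g (add_mset (insert e A) C)))"
proof -
  let ?P = "{A. S \<subseteq> A \<and> A \<subseteq> E}" and ?Q = "{A. S \<subseteq> A \<and> A \<subseteq> E - {e}}"
  have fin: "finite ?P" "finite ?Q"
    using assms(1) by (auto intro: finite_subset[of _ "Pow E"])
  have split: "?P = ?Q \<union> insert e ` ?Q"
  proof (intro equalityI subsetI)
    fix A assume A: "A \<in> ?P"
    show "A \<in> ?Q \<union> insert e ` ?Q"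
    proof (cases "e \<in> A")
      case True
      then have "A = insert e (A - {e})" "A - {e} \<in> ?Q" using A assms(2) by auto
      then show ?thesis by blast
    qed (use A in auto)
  qed (use assms(2) in auto)
  have inj: "inj_on (insert e) ?Q" by (rule inj_onI) blast
  have "(\<Sum>A\<in>?P. (-1) ^ card (A - S) * g (add_mset A C)) =
      (\<Sum>A\<in>?Q. (-1) ^ card (A - S) * g (add_mset A C)) +
      (\<Sum>A\<in>insert e ` ?Q. (-1) ^ card (A - S) * g (add_mset A C))"
    unfolding split by (rule sum.union_disjoint) (use fin in auto)
  also have "(\<Sum>A\<in>insert e ` ?Q. (-1) ^ card (A - S) * g (add_mset A C)) =
      (\<Sum>A\<in>?Q. - ((-1) ^ card (A - S) * g (add_mset (insert e A) C)))"
    unfolding sum.reindex[OF inj] comp_def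
  proof (rule sum.cong[OF refl])
    fix A assume A: "A \<in> ?Q"
    then have "finite A" "insert e A - S = insert e (A - S)" "e \<notin> A"
      using assms finite_subset by auto
    then show "(-1) ^ card (insert e A - S) * g (add_mset (insert e A) C) =
        - ((-1) ^ card (A - S) * g (add_mset (insert e A) C))" by simp
  qed
  finally show ?thesis
    by (simp add: x_op_def sum_negf sum_subtractf right_diff_distrib)
qed

lemma alternating_sum_subsets:
  assumes "finite A" "i \<in> A"
  shows "(\<Sum>S | i \<in> S \<and> S \<subseteq> A. (-1) ^ card (A - S)) = (of_bool (A = {i}) :: real)"
proof -
  let ?B = "A - {i}"
  have eq: "{S. i \<in> S \<and> S \<subseteq> A} = insert i ` Pow ?B"
  proof (intro equalityI subsetI)
    fix S assume "S \<in> {S. i \<in> S \<and> S \<subseteq> A}"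
    then have "S = insert i (S - {i})" "S - {i} \<in> Pow ?B" by auto
    then show "S \<in> insert i ` Pow ?B" by blast
  qed (use assms in auto)
  have inj: "inj_on (insert i) (Pow ?B)"
  proof (rule inj_onI)
    fix X Y assume "X \<in> Pow ?B" "Y \<in> Pow ?B" and eq: "insert i X = insert i Y"
    then have "i \<notin> X" "i \<notin> Y" by auto
    then show "X = Y" using eq by (simp add: insert_ident)
  qed
  have "(\<Sum>S | i \<in> S \<and> S \<subseteq> A. (-1) ^ card (A - S)) =
      (\<Sum>S\<in>Pow ?B. (-1) ^ card (A - insert i S) :: real)"
    unfolding eq sum.reindex[OF inj] by simp
  \<comment> \<open>The sum is read as the expansion of the product of the factors
    \<open>1 + -1\<close> over \<open>A - {i}\<close>.\<close>
  also have "\<dots> = (\<Sum>S\<in>Pow ?B. (\<Prod>x\<in>S. 1) * (\<Prod>x\<in>?B - S. -1))"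
  proof (rule sum.cong[OF refl])
    fix S
    have "A - insert i S = ?B - S" by blast
    then show "(-1) ^ card (A - insert i S) = (\<Prod>x\<in>S. 1) * (\<Prod>x\<in>?B - S. -1 :: real)" by simp
  qed
  also have "\<dots> = (\<Prod>x\<in>?B. 1 + -1)"
    using assms by (subst prod_add) auto
  also have "\<dots> = of_bool (?B = {})"
    using finite_Diff[OF assms(1), of "{i}"]
    by (simp add: power_0_left card_eq_0_iff del: card_Diff_insert)
  also have "?B = {} \<longleftrightarrow> A = {i}" using assms by blast
  finally show ?thesis .
qed

text \<open>Moebius inversion: after interchanging the sums, the inner alternating sum is zero
  unless \<open>A = {i}\<close>, which leaves \<open>- h_{i}\<close>. The term \<open>S = E\<close>,
  equal to \<open>- h_E\<close>, is then moved across.\<close>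

lemma x_op_sum_containing:
  assumes "finite E" "i \<in> E"
  shows "(\<Sum>S | i \<in> S \<and> S \<subset> E. x_op E S g C) = g (add_mset E C) - g (add_mset {i} C)"
proof -
  let ?h = "\<lambda>A. g (add_mset A C)"
  have fin: "finite {S. i \<in> S \<and> S \<subseteq> A}" if "A \<subseteq> E" for A
    by (rule finite_subset[of _ "Pow E"]) (use that assms(1) in auto)
  have "(\<Sum>S | i \<in> S \<and> S \<subseteq> E. x_op E S g C) =
      - (\<Sum>S\<in>{S. i \<in> S \<and> S \<subseteq> E}. \<Sum>A\<in>{A. A \<in> {A. i \<in> A \<and> A \<subseteq> E} \<and> S \<subseteq> A}.
          (-1) ^ card (A - S) * ?h A)"
    unfolding x_op_def sum_negf by (intro arg_cong[of _ _ uminus] sum.cong) auto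
  also have "\<dots> = - (\<Sum>A\<in>{A. i \<in> A \<and> A \<subseteq> E}. \<Sum>S\<in>{S. S \<in> {S. i \<in> S \<and> S \<subseteq> E} \<and> S \<subseteq> A}.
          (-1) ^ card (A - S) * ?h A)"
    by (subst sum.swap_restrict) (use fin in auto)
  also have "\<dots> = - (\<Sum>A\<in>{A. i \<in> A \<and> A \<subseteq> E}. of_bool (A = {i}) * ?h A)"
  proof (intro arg_cong[of _ _ uminus] sum.cong refl)
    fix A assume A: "A \<in> {A. i \<in> A \<and> A \<subseteq> E}"
    then have "{S. S \<in> {S. i \<in> S \<and> S \<subseteq> E} \<and> S \<subseteq> A} = {S. i \<in> S \<and> S \<subseteq> A}" by auto
    moreover have "finite A" "i \<in> A" using A assms finite_subset by auto
    ultimately show "(\<Sum>S\<in>{S. S \<in> {S. i \<in> S \<and> S \<subseteq> E} \<and> S \<subseteq> A}. (-1) ^ card (A - S) * ?h A) =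
        of_bool (A = {i}) * ?h A"
      using alternating_sum_subsets[of A i] by (simp flip: sum_distrib_right)
  qed
  also have "\<dots> = - ?h {i}"
    using fin[of E] assms(2) by (simp add: of_bool_def if_distrib[of "\<lambda>x. x * _"] cong: if_cong)
  finally have total: "(\<Sum>S | i \<in> S \<and> S \<subseteq> E. x_op E S g C) = - ?h {i}" .
  have "{A. E \<subseteq> A \<and> A \<subseteq> E} = {E}" by auto
  then have top: "x_op E E g C = - ?h E" by (simp add: x_op_def)
  have "{S. i \<in> S \<and> S \<subseteq> E} = insert E {S. i \<in> S \<and> S \<subset> E}" using assms by auto
  moreover have "finite {S. i \<in> S \<and> S \<subset> E}"
    using fin[of E] by (rule rev_finite_subset) auto
  ultimately have "(\<Sum>S | i \<in> S \<and> S \<subseteq> E. x_op E S g C) =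
      x_op E E g C + (\<Sum>S | i \<in> S \<and> S \<subset> E. x_op E S g C)"
    by simp
  then show ?thesis using total top by simp
qed

section \<open>Values of monomials\<close>

text \<open>The value of the product of the \<open>x_S\<close> over \<open>X\<close> times the
  product of the \<open>h_A\<close> over \<open>C\<close>. The second multiset is carried along
  because rewriting \<open>x_S\<close> creates factors \<open>h_A\<close>.\<close>

definition monomial_value :: "'a set \<Rightarrow> 'a set set \<Rightarrow> 'a set multiset \<Rightarrow> 'a set multiset \<Rightarrow> real" where
  "monomial_value E M X = fold_mset (x_op E) (\<lambda>C. of_bool (dragon E M C)) X"

lemma monomial_value_empty: "monomial_value E M {#} C = of_bool (dragon E M C)"
  by (simp add: monomial_value_def)

lemma monomial_value_add:
  "monomial_value E M (add_mset S X) = x_op E S (monomial_value E M X)"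
proof -
  interpret comp_fun_commute "x_op E"
    by standard (simp add: fun_eq_iff x_op_commute)
  show ?thesis by (simp add: monomial_value_def)
qed

context finite_matroid
begin

text \<open>For \<open>e\<close> in the closure of \<open>S\<close> but outside \<open>S\<close>,
  the dragon condition does not distinguish \<open>A\<close> from \<open>insert e A\<close>, so the
  pairs cancel. Further variables are commuted outwards.\<close>

lemma monomial_value_nonflat:
  assumes "S \<subseteq> E" "\<not> flat E M S" "{} \<notin># add_mset S X" "{} \<notin># C"
  shows "monomial_value E M (add_mset S X) C = 0"
  using assms(3,4)
proof (induction X arbitrary: C)
  case empty
  obtain e where e: "e \<in> E - S" "rk (insert e S) \<le> rk S"
    using assms(1,2) by (auto simp: flat_def not_less)
  then have "rk (insert e S) = rk S" using rank_mono[of S "insert e S"] by (simp add: le_antisym subset_insertI)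
  then have "dragon E M (add_mset (insert e A) C) = dragon E M (add_mset A C)" if "S \<subseteq> A" for A
    using dragon_insert_closure that e by blast
  then show ?case
    using e(1) finite_E by (simp add: monomial_value_add monomial_value_empty x_op_pairing[of E e S])
next
  case (add T X)
  have "x_op E S (x_op E T (monomial_value E M X)) C = 0"
    unfolding x_op_commute[of E S T]
    by (rule x_op_eq_0) (use add in \<open>auto simp: monomial_value_add\<close>)
  then show ?case by (simp add: monomial_value_add)
qed

text \<open>With \<open>e\<close> in \<open>T - S\<close> and \<open>f\<close> in
  \<open>S - T\<close>, pair \<open>A\<close> with \<open>insert e A\<close> and \<open>B\<close>
  with \<open>insert f B\<close>; each four-term sum is zero by
  \<open>dragon_exchange\<close>.\<close>

lemma monomial_value_incomparable:
  assumes "S \<subseteq> E" "T \<subseteq> E" "\<not> S \<subseteq> T" "\<not> T \<subseteq> S" "{} \<notin># X" "{} \<notin># C"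
  shows "monomial_value E M (add_mset S (add_mset T X)) C = 0"
  using assms(5,6)
proof (induction X arbitrary: C)
  case empty
  obtain e f where e: "e \<in> T" "e \<notin> S" "e \<in> E" and f: "f \<in> S" "f \<notin> T" "f \<in> E"
    using assms by blast
  let ?d = "\<lambda>C. of_bool (dragon E M C) :: real"
  have "x_op E T ?d (add_mset A C) - x_op E T ?d (add_mset (insert e A) C) = 0" if "S \<subseteq> A" for A
  proof -
    have "?d (add_mset B (add_mset A C)) - ?d (add_mset (insert f B) (add_mset A C)) =
        ?d (add_mset B (add_mset (insert e A) C)) - ?d (add_mset (insert f B) (add_mset (insert e A) C))"
      if "T \<subseteq> B" for B
    proof -
      have "f \<in> A" "e \<in> B" using e f \<open>S \<subseteq> A\<close> that by auto
      then show ?thesis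
        using dragon_exchange[of C f A e B] e f empty.prems(2)
        unfolding add_mset_commute[of B] add_mset_commute[of "insert f B"] by linarith
    qed
    then show ?thesis
      using f finite_E by (simp add: x_op_pairing[of E f T])
  qed
  then show ?case
    using e finite_E
    by (simp add: monomial_value_add monomial_value_empty[abs_def] x_op_pairing[of E e S])
next
  case (add U X)
  have "x_op E S (x_op E T (x_op E U (monomial_value E M X))) C =
      x_op E U (x_op E S (x_op E T (monomial_value E M X))) C"
    by (simp add: x_op_commute)
  also have "\<dots> = 0"
    by (rule x_op_eq_0) (use add in \<open>auto simp: monomial_value_add\<close>)
  finally show ?case by (simp add: monomial_value_add)
qed

lemma monomial_value_singleton: "i \<in> E \<Longrightarrow> monomial_value E M X (add_mset {i} C) = 0"
proof (induction X arbitrary: C)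
  case (add T X)
  then have "monomial_value E M X (add_mset A (add_mset {i} C)) = 0" for A
    unfolding add_mset_commute[of A "{i}" C] by blast
  then show ?case by (simp add: monomial_value_add x_op_def)
qed (simp add: monomial_value_empty dragon_singleton)

text \<open>The singleton term of the Moebius formula vanishes, so the sum acts as
  \<open>h_E\<close> whichever \<open>i\<close> is chosen. This is the source of the linear
  relations.\<close>

lemma monomial_value_sum_containing:
  assumes "i \<in> E"
  shows "(\<Sum>S | i \<in> S \<and> S \<subset> E. monomial_value E M (add_mset S X) C) =
    monomial_value E M X (add_mset E C)"
  using assms finite_E monomial_value_singleton
  by (simp add: monomial_value_add x_op_sum_containing)

text \<open>A flat of rank above the number of factors leaves too little room above it. When one
  \<open>h_E\<close> is expanded at an \<open>i\<close> outside \<open>G\<close>, only flats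
  strictly above \<open>G\<close> contribute, and their rank is again too high. With no
  \<open>h_E\<close> left, \<open>G\<close> would have rank above \<open>r\<close>, impossible for a
  proper flat.\<close>

lemma monomial_value_high_rank:
  assumes "rk E = r + 1" "set_mset X \<subseteq> proper_flats E M" "G \<in># X" "size X < rk G" "size X + k = r"
  shows "monomial_value E M X (replicate_mset k E) = 0"
  using assms(2-5)
proof (induction k arbitrary: X G)
  case 0
  then show ?case using proper_flat_rank_less[of G] assms(1) by auto
next
  case (Suc k)
  have G: "flat E M G" "G \<subseteq> E" "G \<noteq> E" "G \<noteq> {}"
    using Suc.prems by (auto simp: proper_flats_def flat_def)
  then obtain i where i: "i \<in> E" "i \<notin> G" by blast
  have X: "{} \<notin># X" using Suc.prems(1) by (auto simp: proper_flats_def)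
  have C: "{} \<notin># replicate_mset k E" using i by auto
  have "monomial_value E M (add_mset S X) (replicate_mset k E) = 0" if S: "i \<in> S" "S \<subset> E" for S
  proof (cases "flat E M S \<and> G \<subseteq> S")
    case True
    then have "G \<subset> S" using S i by blast
    then have "rk G < rk S" using flat_rank_less[OF G(1)] S by blast
    then show ?thesis
      using Suc.prems True S by (intro Suc.IH[of _ S]) (auto simp: proper_flats_def)
  next
    case False
    then consider "\<not> flat E M S" | "\<not> G \<subseteq> S" by blast
    then show ?thesis
    proof cases
      case 1
      then show ?thesis using monomial_value_nonflat[of S X "replicate_mset k E"] S X C by auto
    next
      case 2
      obtain Y where Y: "X = add_mset G Y" using Suc.prems(2) multi_member_split by metis
      show ?thesis
        unfolding Y by (rule monomial_value_incomparable) (use S i G 2 X Y C in auto)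
    qed
  qed
  then show ?case
    using monomial_value_sum_containing[OF i(1), of X "replicate_mset k E"] by simp
qed

section \<open>Ranks and values of complete flags\<close>

lemma flag_rank_diff:
  assumes "complete_flag E M r F" "1 \<le> k" "k \<le> j" "j \<le> r"
  shows "rk (F k) + (j - k) \<le> rk (F j)"
  using assms(3,4)
proof (induction j rule: dec_induct)
  case base
  then show ?case by simp
next
  case (step j)
  have "F j \<in> proper_flats E M" "F (Suc j) \<in> proper_flats E M" "F j \<subset> F (Suc j)"
    using assms(1,2) step by (auto simp: complete_flag_def)
  then have "rk (F j) < rk (F (Suc j))"
    by (intro flat_rank_less) (auto simp: proper_flats_def flat_def)
  then show ?case using step by linarith
qed

text \<open>The bottom has rank at least one as there are no loops, the top at most \<open>r\<close>
  as it is proper, and each of the \<open>r - 1\<close> inclusions raises the rank; so all bounds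
  are equalities.\<close>

lemma flag_rank:
  assumes "loopless E M" "rk E = r + 1" "complete_flag E M r F" "k \<in> {1..r}"
  shows "rk (F k) = k"
proof -
  have F: "F 1 \<in> proper_flats E M" "F r \<in> proper_flats E M"
    using assms(3,4) by (auto simp: complete_flag_def)
  then obtain i where i: "i \<in> F 1" "i \<in> E" by (auto simp: proper_flats_def flat_def)
  have "rk {i} \<le> rk (F 1)" by (rule rank_mono) (use i in auto)
  then have "1 \<le> rk (F 1)" using assms(1) i by (simp add: loopless_def)
  moreover have "rk (F 1) + (k - 1) \<le> rk (F k)" "rk (F k) + (r - k) \<le> rk (F r)"
    using flag_rank_diff[OF assms(3)] assms(4) by auto
  moreover have "rk (F r) < r + 1" using proper_flat_rank_less F(2) assms(2) by metis
  ultimately show ?thesis using assms(4) by auto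
qed

text \<open>Each step multiplies by \<open>h\<^sub>E = \<Sum>\<^sub>G\<^sub>\<ni>\<^sub>i x\<^sub>G\<close> with \<open>i \<in> F\<^sub>k\<^sub>+\<^sub>1 - F\<^sub>k\<close>; only \<open>G = F\<^sub>k\<^sub>+\<^sub>1\<close> survives.\<close>

lemma monomial_value_flag_prefix:
  assumes "loopless E M" "rk E = r + 1" "complete_flag E M r F" "k \<le> r"
  shows "monomial_value E M (image_mset F (mset_set {1..k})) (replicate_mset (r - k) E) = 1"
  using assms(4)
proof (induction k)
  case 0
  \<comment> \<open>Only \<open>S = E\<close> contains the copies of \<open>E\<close>, and there
    \<open>r < r + 1\<close>; every other nonempty set counts zero and has positive rank as there
    are no loops.\<close>
  have "dragon E M (replicate_mset r E)"
    unfolding dragon_def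
  proof (intro allI impI)
    fix S assume S: "S \<subseteq> E" "S \<noteq> {}"
    show "subcount (replicate_mset r E) S < rk S"
    proof (cases "S = E")
      case True
      then show ?thesis using assms(2) by (simp add: subcount_replicate)
    next
      case False
      then have "subcount (replicate_mset r E) S = 0"
        using S by (auto simp: subcount_replicate)
      moreover obtain i where i: "i \<in> S" using S by blast
      have "rk {i} \<le> rk S" by (rule rank_mono) (use i in auto)
      then have "0 < rk S" using assms(1) i S by (auto simp: loopless_def)
      ultimately show ?thesis by simp
    qed
  qed
  then show ?case by (simp add: monomial_value_empty)
next
  case (Suc k)
  define X where "X = image_mset F (mset_set {1..k})"
  define C where "C = replicate_mset (r - Suc k) E"
  \<comment> \<open>\<open>G\<close> is the last flat used, with the empty set in place of
    \<open>F 0\<close>, on which a flag puts no condition.\<close>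
  define G where "G = (if k = 0 then {} else F k)"
  have flats: "F j \<in> proper_flats E M" if "j \<in> {1..r}" for j
    using assms(3) that by (simp add: complete_flag_def)
  have F: "flat E M (F (Suc k))" "F (Suc k) \<subseteq> E" "F (Suc k) \<noteq> E" "F (Suc k) \<noteq> {}"
    using flats[of "Suc k"] Suc.prems by (auto simp: proper_flats_def flat_def)
  have "G \<subset> F (Suc k)"
    using assms(3) Suc.prems F(4) by (auto simp: G_def complete_flag_def)
  then obtain i where i: "i \<in> F (Suc k)" "i \<notin> G" by blast
  have rkG: "rk G = k" using flag_rank[OF assms(1-3), of k] Suc.prems by (auto simp: G_def)
  have rkF: "rk (F (Suc k)) = Suc k" using flag_rank[OF assms(1-3), of "Suc k"] Suc.prems by auto
  have X: "set_mset X \<subseteq> proper_flats E M" "size X = k"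
    using flats Suc.prems by (auto simp: X_def)
  then have X': "{} \<notin># X" by (auto simp: proper_flats_def)
  have C: "{} \<notin># C" using F by (auto simp: C_def)
  have rkiG: "rk G < rk (insert i G)"
  proof (cases "k = 0")
    case True
    then show ?thesis using assms(1) i F(2) by (auto simp: G_def loopless_def)
  next
    case False
    then have "flat E M G" using flats[of k] Suc.prems by (auto simp: G_def proper_flats_def)
    then show ?thesis using i F(2) by (auto simp: flat_def)
  qed
  \<comment> \<open>Three reasons for vanishing: \<open>S\<close> is no flat; \<open>S\<close> is
    incomparable with \<open>G\<close>, since it contains \<open>i\<close>; or \<open>S\<close> is a
    flat above \<open>G\<close> whose rank exceeds \<open>Suc k\<close>.\<close>
  have other: "monomial_value E M (add_mset S X) C = 0"
    if S: "i \<in> S" "S \<subset> E" "S \<noteq> F (Suc k)" for S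
  proof -
    consider "\<not> flat E M S" | "\<not> G \<subseteq> S" | "flat E M S" "G \<subseteq> S" by blast
    then show ?thesis
    proof cases
      case 1
      then show ?thesis using monomial_value_nonflat[of S X C] S X' C by auto
    next
      case 2
      then have "k \<noteq> 0" by (auto simp: G_def)
      then have "G \<in># X" by (auto simp: G_def X_def)
      then obtain Y where Y: "X = add_mset G Y" using multi_member_split by metis
      show ?thesis
        unfolding Y
        by (rule monomial_value_incomparable) (use S i 2 X' Y C F(2) \<open>G \<subset> F (Suc k)\<close> in auto)
    next
      case 3
      have "rk (insert i G) \<le> rk S" by (rule rank_mono) (use 3 S in auto)
      moreover have "rk S \<noteq> Suc k"
        using flat_eq_of_rank_Suc[of S "F (Suc k)" i G] 3 S F(1) i \<open>G \<subset> F (Suc k)\<close> rkiG rkG rkF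
        by auto
      ultimately have "Suc k < rk S" using rkiG rkG by linarith
      then show ?thesis
        unfolding C_def using S 3 X Suc.prems
        by (intro monomial_value_high_rank[OF assms(2), of _ S]) (auto simp: proper_flats_def)
    qed
  qed
  have "1 = monomial_value E M X (add_mset E C)"
    using Suc by (simp add: X_def C_def Suc_diff_Suc flip: replicate_mset_Suc)
  also have "\<dots> = (\<Sum>S | i \<in> S \<and> S \<subset> E. monomial_value E M (add_mset S X) C)"
    by (rule monomial_value_sum_containing[symmetric]) (use i F in auto)
  also have "\<dots> = (\<Sum>S\<in>{F (Suc k)}. monomial_value E M (add_mset S X) C)"
  proof (rule sum.mono_neutral_right)
    show "finite {S. i \<in> S \<and> S \<subset> E}"
      by (rule finite_subset[of _ "Pow E"]) (use finite_E in auto)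
    show "{F (Suc k)} \<subseteq> {S. i \<in> S \<and> S \<subset> E}" using i F by blast
    show "\<forall>S\<in>{S. i \<in> S \<and> S \<subset> E} - {F (Suc k)}. monomial_value E M (add_mset S X) C = 0"
      using other by blast
  qed
  also have "\<dots> = monomial_value E M (add_mset (F (Suc k)) X) C" by simp
  finally show ?case by (simp add: X_def C_def atLeastAtMostSuc_conv)
qed

lemma monomial_value_flag:
  assumes "loopless E M" "rk E = r + 1" "complete_flag E M r F"
  shows "monomial_value E M (image_mset F (mset_set {1..r})) {#} = 1"
  using monomial_value_flag_prefix[OF assms, of r] by simp

text \<open>The singleton of a loop has rank zero and violates the strict inequality for every
  \<open>C\<close>. This accounts for the value zero at matroids with loops.\<close>

lemma not_dragon_if_not_loopless:
  assumes "\<not> loopless E M"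
  shows "\<not> dragon E M C"
proof -
  obtain i where i: "i \<in> E" "rk {i} \<noteq> 1" using assms unfolding loopless_def by blast
  then have "rk {i} = 0" using rank_singleton_le[of i] by linarith
  then have "\<not> subcount C {i} < rk {i}" by simp
  then show ?thesis using i(1) unfolding dragon_def by blast
qed

lemma monomial_value_not_loopless:
  assumes "\<not> loopless E M"
  shows "monomial_value E M X C = 0"
  by (induction X arbitrary: C)
    (simp_all add: monomial_value_empty monomial_value_add x_op_def not_dragon_if_not_loopless[OF assms])

end

section \<open>The dragon Hall-Rado condition and matroid polytopes\<close>

context finite_matroid
begin

lemma rank_le_card: "finite S \<Longrightarrow> rk S \<le> card S"
  using rank_attained[of S] card_mono[of S] by (metis Int_lower1)

text \<open>Rado's theorem in counting form. Elements are removed from the sets while the hypothesis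
  persists, by induction on the total size. Once all sets have at most one element, their union is
  independent and lies in a base.\<close>

lemma rado:
  assumes "\<And>A. A \<in># C \<Longrightarrow> A \<subseteq> E" and "\<And>S. S \<subseteq> E \<Longrightarrow> subcount C S \<le> rk S"
  shows "\<exists>B\<in>M. \<forall>S\<subseteq>E. subcount C S \<le> card (S \<inter> B)"
  using assms
proof (induction "sum_mset (image_mset card C)" arbitrary: C rule: less_induct)
  case less
  show ?case
  proof (cases "\<exists>A. A \<in># C \<and> 1 < card A")
    case False
    let ?I = "\<Union> (set_mset C)"
    have I: "?I \<subseteq> E" using less.prems by blast
    then have fin: "finite ?I" using finite_E finite_subset by blast
    have "card ?I \<le> (\<Sum>A\<in>set_mset C. card A)" by (rule card_Union_le_sum_card)
    also have "\<dots> \<le> (\<Sum>A\<in>set_mset C. 1)" by (rule sum_mono) (use False in force)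
    also have "\<dots> \<le> size C" 
      unfolding size_multiset_overloaded_eq by (rule sum_mono) (simp add: Suc_le_eq)
    also have "\<dots> = subcount C ?I" by (rule subcount_all[symmetric]) blast
    also have "\<dots> \<le> rk ?I" using less.prems I by blast
    finally have "card ?I \<le> rk ?I" .
    moreover obtain B where B: "B \<in> M" "rk ?I = card (?I \<inter> B)" using rank_attained by metis
    ultimately have "?I \<inter> B = ?I" using fin by (intro card_seteq) auto
    have "subcount C S \<le> card (S \<inter> B)" if "S \<subseteq> E" for S
    proof -
      have "subcount C S = subcount C (S \<inter> ?I)"
        unfolding subcount_def by (intro arg_cong[where f = size] filter_mset_cong) auto
      also have "\<dots> \<le> rk (S \<inter> ?I)" using less.prems(2) I by blast
      also have "\<dots> \<le> card (S \<inter> ?I)" using rank_le_card fin by blast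
      also have "\<dots> \<le> card (S \<inter> B)"
        by (rule card_mono) (use \<open>?I \<inter> B = ?I\<close> finite_base[OF B(1)] in auto)
      finally show ?thesis .
    qed
    then show ?thesis using B by blast
  next
    case True
    then obtain A where A: "A \<in># C" "1 < card A" by blast
    then obtain C' where C: "C = add_mset A C'" using multi_member_split by metis
    obtain a b where ab: "a \<in> A" "b \<in> A" "a \<noteq> b"
      using A(2) by (metis One_nat_def card_le_Suc0_iff_eq card_eq_0_iff not_le not_less_zero)
    have "A \<subseteq> E" using less.prems A by blast
    then have finA: "finite A" using finite_E finite_subset by blast
    \<comment> \<open>If removing \<open>a\<close> and removing \<open>b\<close> both failed, the
      violating sets would be tight for \<open>C'\<close> and their union would contain
      \<open>A\<close>; submodularity would then fail by one.\<close>
    have main: "\<exists>z\<in>A. \<forall>S\<subseteq>E. subcount (add_mset (A - {z}) C') S \<le> rk S"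
    proof (rule ccontr)
      assume "\<not> ?thesis"
      then obtain S T where S: "S \<subseteq> E" "rk S < subcount (add_mset (A - {a}) C') S"
        and T: "T \<subseteq> E" "rk T < subcount (add_mset (A - {b}) C') T"
        using ab by (meson not_le)
      have bound: "of_bool (A \<subseteq> U) + subcount C' U \<le> rk U" if "U \<subseteq> E" for U
        using less.prems(2)[OF that] C by simp
      have S': "A - {a} \<subseteq> S" "rk S \<le> subcount C' S"
        using S(2) bound[OF S(1)] by (auto simp: of_bool_def split: if_splits)
      have T': "A - {b} \<subseteq> T" "rk T \<le> subcount C' T"
        using T(2) bound[OF T(1)] by (auto simp: of_bool_def split: if_splits)
      have "A \<subseteq> S \<union> T" using S' T' ab by blast
      then have "1 + subcount C' (S \<union> T) \<le> rk (S \<union> T)" using bound[of "S \<union> T"] S T by simp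
      moreover have "S \<inter> T \<subseteq> E" using S(1) by blast
      then have "subcount C' (S \<inter> T) \<le> rk (S \<inter> T)" using bound[of "S \<inter> T"] by linarith
      ultimately show False
        using S' T' rank_submodular[of S T] subcount_supermodular[of C' S T] by linarith
    qed
    then obtain z where z: "z \<in> A" "\<And>S. S \<subseteq> E \<Longrightarrow> subcount (add_mset (A - {z}) C') S \<le> rk S"
      by blast
    let ?C = "add_mset (A - {z}) C'"
    have "card (A - {z}) < card A" using z finA by (intro psubset_card_mono) auto
    then have "sum_mset (image_mset card ?C) < sum_mset (image_mset card C)" using C by simp
    moreover have "\<And>A. A \<in># ?C \<Longrightarrow> A \<subseteq> E" using less.prems(1) C by auto
    ultimately obtain B where B: "B \<in> M" "\<And>S. S \<subseteq> E \<Longrightarrow> subcount ?C S \<le> card (S \<inter> B)"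
      using less.hyps[of ?C] z(2) by blast
    have "subcount C S \<le> subcount ?C S" for S unfolding C by (rule subcount_antimono) blast
    then show ?thesis using B le_trans by meson
  qed
qed

text \<open>The strict inequality leaves room for one more set: Rado's theorem is applied to
  \<open>C\<close> with \<open>{e}\<close> added.\<close>

lemma dragon_transversal_base:
  assumes "dragon E M C" "{} \<notin># C" "\<And>A. A \<in># C \<Longrightarrow> A \<subseteq> E" "e \<in> E"
  shows "\<exists>B\<in>M. \<forall>S\<subseteq>E. of_bool (e \<in> S) + subcount C S \<le> card (S \<inter> B)"
proof -
  have "subcount (add_mset {e} C) S \<le> rk S" if "S \<subseteq> E" for S
  proof (cases "S = {}")
    case True
    then show ?thesis using subcount_no_sets[OF assms(2)] by simp
  next
    case False
    then have "subcount C S < rk S" using assms(1) that by (simp add: dragon_def)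
    then show ?thesis by (auto simp: of_bool_def)
  qed
  then have "\<exists>B\<in>M. \<forall>S\<subseteq>E. subcount (add_mset {e} C) S \<le> card (S \<inter> B)"
    by (rule rado[rotated]) (use assms(3,4) in auto)
  then show ?thesis by simp
qed

end

text \<open>The fraction \<open>card S / card E\<close> is positive for nonempty \<open>S\<close>,
  so closed inequalities can force the strict dragon condition. It is also the average over
  \<open>e\<close> in \<open>E\<close> of the indicator of \<open>e \<in> S\<close>.\<close>

definition dragon_polyhedron :: "'a set \<Rightarrow> 'a set multiset \<Rightarrow> ('a \<Rightarrow> real) set" where
  "dragon_polyhedron E C =
     {x. \<forall>S\<subseteq>E. card S / card E + subcount C S \<le> (\<Sum>i\<in>S. x i)}"

lemma sum_fun_apply: "(\<Sum>i\<in>I. f i) x = (\<Sum>i\<in>I. f i x)"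
  by (induction I rule: infinite_finite_induct) auto

lemma sum_indicator_real:
  "finite S \<Longrightarrow> (\<Sum>i\<in>S. indicator B i) = real (card (S \<inter> B))"
  by (induction S rule: finite_induct) (auto simp: Int_insert_left)

lemma convex_coordinate_sum_le: "convex {x :: 'a \<Rightarrow> real. (\<Sum>i\<in>S. x i) \<le> c}"
proof (rule convexI)
  fix x y :: "'a \<Rightarrow> real" and u v :: real
  assume *: "x \<in> {x. (\<Sum>i\<in>S. x i) \<le> c}" "y \<in> {x. (\<Sum>i\<in>S. x i) \<le> c}" "0 \<le> u" "0 \<le> v" "u + v = 1"
  have "(\<Sum>i\<in>S. (u *\<^sub>R x + v *\<^sub>R y) i) = u * (\<Sum>i\<in>S. x i) + v * (\<Sum>i\<in>S. y i)"
    by (simp add: scaleR_fun_def sum.distrib sum_distrib_left)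
  also have "\<dots> \<le> c" using * by (intro convex_bound_le) auto
  finally show "u *\<^sub>R x + v *\<^sub>R y \<in> {x. (\<Sum>i\<in>S. x i) \<le> c}" by simp
qed

lemma convex_coordinate_sum_ge: "convex {x :: 'a \<Rightarrow> real. c \<le> (\<Sum>i\<in>S. x i)}"
proof (rule convexI)
  fix x y :: "'a \<Rightarrow> real" and u v :: real
  assume *: "x \<in> {x. c \<le> (\<Sum>i\<in>S. x i)}" "y \<in> {x. c \<le> (\<Sum>i\<in>S. x i)}" "0 \<le> u" "0 \<le> v" "u + v = 1"
  have "- (u * (\<Sum>i\<in>S. x i) + v * (\<Sum>i\<in>S. y i)) = u * - (\<Sum>i\<in>S. x i) + v * - (\<Sum>i\<in>S. y i)" by simp
  also have "\<dots> \<le> - c" using * by (intro convex_bound_le) auto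
  finally have "c \<le> u * (\<Sum>i\<in>S. x i) + v * (\<Sum>i\<in>S. y i)" by simp
  also have "\<dots> = (\<Sum>i\<in>S. (u *\<^sub>R x + v *\<^sub>R y) i)"
    by (simp add: scaleR_fun_def sum.distrib sum_distrib_left)
  finally show "u *\<^sub>R x + v *\<^sub>R y \<in> {x. c \<le> (\<Sum>i\<in>S. x i)}" by simp
qed

lemma convex_dragon_polyhedron: "convex (dragon_polyhedron E C)"
proof -
  have "dragon_polyhedron E C = (\<Inter>S\<in>Pow E. {x. card S / card E + subcount C S \<le> (\<Sum>i\<in>S. x i)})"
    by (auto simp: dragon_polyhedron_def)
  then show ?thesis by (auto intro!: convex_INT convex_coordinate_sum_ge)
qed

lemma closed_dragon_polyhedron: "closed (dragon_polyhedron E C)"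
proof -
  have "dragon_polyhedron E C = (\<Inter>S\<in>Pow E. {x. card S / card E + subcount C S \<le> (\<Sum>i\<in>S. x i)})"
    by (auto simp: dragon_polyhedron_def)
  moreover have "closed {x :: 'a \<Rightarrow> real. c \<le> (\<Sum>i\<in>S. x i)}" for c and S :: "'a set"
    by (intro closed_Collect_le continuous_intros continuous_on_sum continuous_on_product_coordinates)
  ultimately show ?thesis by auto
qed

context finite_matroid
begin

text \<open>At the vertices, hence on the whole polytope, the coordinate sum over \<open>S\<close>
  is at most \<open>rk S\<close>; the positive fraction makes the comparison strict. For the
  converse a common point is built from transversal bases.\<close>

lemma matroid_polytope_meets_dragon_polyhedron:
  assumes "{} \<notin># C" "\<And>A. A \<in># C \<Longrightarrow> A \<subseteq> E" "E \<noteq> {}"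
  shows "matroid_polytope M \<inter> dragon_polyhedron E C \<noteq> {} \<longleftrightarrow> dragon E M C"
proof
  assume "matroid_polytope M \<inter> dragon_polyhedron E C \<noteq> {}"
  then obtain x where x: "x \<in> matroid_polytope M" "x \<in> dragon_polyhedron E C" by blast
  show "dragon E M C"
    unfolding dragon_def
  proof (intro allI impI)
    fix S assume S: "S \<subseteq> E" "S \<noteq> {}"
    have fin: "finite S" using S finite_E finite_subset by blast
    have "(\<Sum>i\<in>S. indicator B i) \<le> real (rk S)" if "B \<in> M" for B
      using card_Int_base_le[OF that, of S] fin by (simp add: sum_indicator_real)
    then have "matroid_polytope M \<subseteq> {x. (\<Sum>i\<in>S. x i) \<le> rk S}"
      unfolding matroid_polytope_def
      by (intro hull_minimal convex_coordinate_sum_le) auto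
    then have "(\<Sum>i\<in>S. x i) \<le> rk S" using x(1) by blast
    moreover have "card S / card E + subcount C S \<le> (\<Sum>i\<in>S. x i)"
      using x(2) S unfolding dragon_polyhedron_def by blast
    moreover have "0 < card S / card E"
      using S fin finite_E assms(3) by (intro divide_pos_pos) (simp_all add: card_gt_0_iff)
    ultimately have "real (subcount C S) < real (rk S)" by linarith
    then show "subcount C S < rk S" by simp
  qed
next
  assume D: "dragon E M C"
  have "\<exists>B. \<forall>e\<in>E. B e \<in> M \<and> (\<forall>S\<subseteq>E. of_bool (e \<in> S) + subcount C S \<le> card (S \<inter> B e))"
    using dragon_transversal_base[OF D assms(1,2)] by (intro bchoice) blast
  then obtain B where B: "\<And>e. e \<in> E \<Longrightarrow> B e \<in> M"
    "\<And>e S. e \<in> E \<Longrightarrow> S \<subseteq> E \<Longrightarrow> of_bool (e \<in> S) + subcount C S \<le> card (S \<inter> B e)"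
    by blast
  have n: "0 < card E" using assms(3) finite_E by (simp add: card_gt_0_iff)
  \<comment> \<open>The barycentre of the bases \<open>B e\<close>: averaging their bounds turns
    \<open>of_bool (e \<in> S)\<close> into \<open>card S / card E\<close>.\<close>
  define x :: "'a \<Rightarrow> real" where "x = (\<Sum>e\<in>E. (1 / card E) *\<^sub>R indicator (B e))"
  have "x \<in> matroid_polytope M"
    unfolding x_def matroid_polytope_def
    by (rule convex_sum) (use B n finite_E in \<open>auto intro: hull_inc\<close>)
  moreover have "x \<in> dragon_polyhedron E C"
    unfolding dragon_polyhedron_def
  proof (intro CollectI allI impI)
    fix S assume S: "S \<subseteq> E"
    then have fin: "finite S" using finite_E finite_subset by blast
    have "card S / card E + subcount C S = (\<Sum>e\<in>E. (of_bool (e \<in> S) + real (subcount C S)) / card E)"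
    proof -
      have "(\<Sum>e\<in>E. of_bool (e \<in> S)) = real (card S)"
        using S finite_E by (simp add: of_bool_def sum.If_cases Int_absorb1)
      then show ?thesis using n by (simp add: sum.distrib field_simps flip: sum_divide_distrib)
    qed
    also have "\<dots> \<le> (\<Sum>e\<in>E. card (S \<inter> B e) / card E)"
    proof (intro sum_mono divide_right_mono)
      fix e assume "e \<in> E"
      then have "real (of_bool (e \<in> S) + subcount C S) \<le> real (card (S \<inter> B e))"
        using B(2) S by (simp only: of_nat_le_iff)
      then show "of_bool (e \<in> S) + real (subcount C S) \<le> real (card (S \<inter> B e))" by simp
    qed simp
    also have "\<dots> = (\<Sum>e\<in>E. \<Sum>i\<in>S. indicator (B e) i / card E)"
      using fin by (simp add: sum_indicator_real flip: sum_divide_distrib)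
    also have "\<dots> = (\<Sum>i\<in>S. x i)"
      unfolding x_def sum_fun_apply by (subst sum.swap) (simp add: scaleR_fun_def)
    finally show "card S / card E + subcount C S \<le> (\<Sum>i\<in>S. x i)" .
  qed
  ultimately show "matroid_polytope M \<inter> dragon_polyhedron E C \<noteq> {}" by blast
qed

end

subsection \<open>Euler characteristic of compact convex sets\<close>

text \<open>Only right endpoints contribute: the jump of \<open>\<Sum> a\<^sub>i 1\<^bsub>K\<^sub>i\<^esub>\<close> to the right of \<open>v\<close> is the sum of
  the \<open>a\<^sub>i\<close> over the intervals that end at \<open>v\<close>.\<close>

lemma interval_relation_nonempty:
  fixes a :: "'i \<Rightarrow> int" and K :: "'i \<Rightarrow> real set"
  assumes "finite I" "\<And>i. i \<in> I \<Longrightarrow> compact (K i)" "\<And>i. i \<in> I \<Longrightarrow> convex (K i)"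
    and rel: "\<And>t. (\<Sum>i\<in>I. a i * of_bool (t \<in> K i)) = 0"
  shows "(\<Sum>i\<in>I. a i * of_bool (K i \<noteq> {})) = 0"
proof -
  define J where "J = {i \<in> I. K i \<noteq> {}}"
  define u where "u i = Sup (K i)" for i
  have fin: "finite J" using assms(1) by (simp add: J_def)
  have u: "u i \<in> K i" "\<And>t. t \<in> K i \<Longrightarrow> t \<le> u i" if "i \<in> J" for i
  proof -
    have "K i \<noteq> {}" "closed (K i)" "bdd_above (K i)"
      using that assms(2)[of i]
      by (auto simp: J_def intro: bounded_imp_bdd_above compact_imp_bounded compact_imp_closed)
    then show "u i \<in> K i" "\<And>t. t \<in> K i \<Longrightarrow> t \<le> u i"
      unfolding u_def by (auto intro: closed_contains_Sup cSup_upper)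
  qed
  have "(\<Sum>i\<in>{i \<in> J. u i = v}. a i) = 0" for v
  proof -
    \<comment> \<open>Just to the right of \<open>v\<close> membership is constant:
      \<open>K i\<close> continues past \<open>v\<close> exactly if it contains \<open>v\<close> and
      does not end there. Closedness settles the case of \<open>v\<close> outside
      \<open>K i\<close>.\<close>
    have "eventually (\<lambda>t. t \<in> K i \<longleftrightarrow> v \<in> K i \<and> v < u i) (at_right v)" if i: "i \<in> I" for i
    proof (cases "v \<in> K i")
      case True
      then have iJ: "i \<in> J" using i by (auto simp: J_def)
      show ?thesis
      proof (cases "v < u i")
        case lt: True
        have "eventually (\<lambda>t. t \<in> {v<..<u i}) (at_right v)"
          using lt by (rule eventually_at_right_real)
        then show ?thesis
        proof (rule eventually_mono)
          fix t assume t: "t \<in> {v<..<u i}"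
          have "is_interval (K i)" using assms(3) i by (simp add: is_interval_convex_1)
          then have "t \<in> K i" using True u(1)[OF iJ] t by (meson greaterThanLessThan_iff less_imp_le mem_is_interval_1_I)
          then show "t \<in> K i \<longleftrightarrow> v \<in> K i \<and> v < u i" using True lt by simp
        qed
      next
        case False
        have "eventually (\<lambda>t. v < t) (at_right v)" by (simp add: eventually_at_right_less)
        then show ?thesis
          by (rule eventually_mono) (use u(2)[OF iJ] False in fastforce)
      qed
    next
      case False
      have "open (- K i)" using assms(2) i compact_imp_closed by blast
      then have "eventually (\<lambda>t. t \<in> - K i) (nhds v)" using False eventually_nhds by blast
      then have "eventually (\<lambda>t. t \<in> - K i) (at_right v)"
        by (simp add: eventually_at_filter eventually_mono)
      then show ?thesis by (rule eventually_mono) (use False in auto)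
    qed
    then have "eventually (\<lambda>t. \<forall>i\<in>I. t \<in> K i \<longleftrightarrow> v \<in> K i \<and> v < u i) (at_right v)"
      using assms(1) by (intro eventually_ball_finite) auto
    \<comment> \<open>One \<open>t\<close> serves all of the finitely many sets; those that contain
      \<open>v\<close> but not \<open>t\<close> are exactly those that end at
      \<open>v\<close>.\<close>
    then obtain t where t: "\<And>i. i \<in> I \<Longrightarrow> t \<in> K i \<longleftrightarrow> v \<in> K i \<and> v < u i"
      using eventually_happens'[OF trivial_limit_at_right_real] by blast
    have "(\<Sum>i\<in>{i \<in> J. u i = v}. a i) = (\<Sum>i\<in>{i \<in> I. i \<in> J \<and> u i = v}. a i)"
      by (rule sum.cong) (auto simp: J_def)
    also have "\<dots> = (\<Sum>i\<in>I. a i * of_bool (i \<in> J \<and> u i = v))"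
      using assms(1) by (simp add: sum.inter_filter of_bool_def if_distrib cong: if_cong)
    also have "\<dots> = (\<Sum>i\<in>I. a i * of_bool (v \<in> K i) - a i * of_bool (t \<in> K i))"
    proof (rule sum.cong[OF refl])
      fix i assume i: "i \<in> I"
      have "v \<in> K i \<Longrightarrow> i \<in> J \<and> v \<le> u i" using i u(2)[of i v] by (auto simp: J_def)
      moreover have "i \<in> J \<and> u i = v \<Longrightarrow> v \<in> K i" using u(1)[of i] by auto
      ultimately have "(i \<in> J \<and> u i = v) \<longleftrightarrow> v \<in> K i \<and> t \<notin> K i" using t[OF i] by auto
      then show "a i * of_bool (i \<in> J \<and> u i = v) = a i * of_bool (v \<in> K i) - a i * of_bool (t \<in> K i)"
        using t[OF i] by (auto simp: of_bool_def)
    qed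
    also have "\<dots> = 0" using rel by (simp add: sum_subtractf)
    finally show ?thesis .
  qed
  then have "(\<Sum>i\<in>J. a i) = 0"
    using sum.image_gen[OF fin, of a u] by simp
  then show ?thesis
    using assms(1) by (simp add: J_def sum.inter_filter of_bool_def if_distrib cong: if_cong)
qed

text \<open>Integration against the Euler characteristic, one coordinate at a time: coordinates in
  \<open>S\<close> are free, the others are fixed by \<open>y\<close>. For empty \<open>S\<close>
  this is the given relation.\<close>

lemma convex_relation_fiber:
  fixes a :: "'i \<Rightarrow> int" and K :: "'i \<Rightarrow> ('a \<Rightarrow> real) set"
  assumes "finite I" "\<And>i. i \<in> I \<Longrightarrow> compact (K i)" "\<And>i. i \<in> I \<Longrightarrow> convex (K i)"
    and rel: "\<And>x. (\<Sum>i\<in>I. a i * of_bool (x \<in> K i)) = 0"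
    and "finite S"
  shows "(\<Sum>i\<in>I. a i * of_bool (\<exists>x\<in>K i. \<forall>j. j \<notin> S \<longrightarrow> x j = y j)) = 0"
  using assms(5)
proof (induction S arbitrary: y rule: finite_induct)
  case empty
  have "(\<exists>x\<in>K i. \<forall>j. x j = y j) \<longleftrightarrow> y \<in> K i" for i by (metis ext)
  then show ?case using rel by simp
next
  case (insert s S)
  define H where "H = {x :: 'a \<Rightarrow> real. \<forall>j. j \<notin> insert s S \<longrightarrow> x j = y j}"
  \<comment> \<open>The shadow of the slice on coordinate \<open>s\<close> is a compact convex
    subset of the line, nonempty exactly when the slice is.\<close>
  define L where "L i = (\<lambda>x. x s) ` (K i \<inter> H)" for i
  have "closed H"
  proof -
    have "H = (\<Inter>j\<in>- insert s S. {x. x j = y j})" by (auto simp: H_def)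
    moreover have "closed {x :: 'a \<Rightarrow> real. x j = y j}" for j
      by (intro closed_Collect_eq continuous_on_product_coordinates continuous_intros)
    ultimately show ?thesis by auto
  qed
  have "convex H"
    by (rule convexI) (auto simp: H_def scaleR_fun_def simp flip: distrib_right)
  have compact: "compact (L i)" if "i \<in> I" for i
    unfolding L_def
    by (intro compact_continuous_image compact_Int_closed assms(2)[OF that] \<open>closed H\<close>)
      (rule continuous_on_subset[OF continuous_on_product_coordinates]; simp)
  have "linear (\<lambda>x :: 'a \<Rightarrow> real. x s)"
    by (rule linearI) (auto simp: scaleR_fun_def)
  then have convex: "convex (L i)" if "i \<in> I" for i
    unfolding L_def
    by (intro convex_linear_image convex_Int assms(3)[OF that] \<open>convex H\<close>)
  \<comment> \<open>Membership of \<open>t\<close> in the shadow means that the slice with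
    coordinate \<open>s\<close> fixed at \<open>t\<close> is nonempty, so the induction hypothesis
    at \<open>y(s := t)\<close> is a relation between intervals.\<close>
  have "t \<in> L i \<longleftrightarrow> (\<exists>x\<in>K i. \<forall>j. j \<notin> S \<longrightarrow> x j = (y(s := t)) j)" for t i
    using insert.hyps(2) by (auto simp: L_def H_def)
  then have "(\<Sum>i\<in>I. a i * of_bool (t \<in> L i)) = 0" for t using insert.IH by simp
  then have "(\<Sum>i\<in>I. a i * of_bool (L i \<noteq> {})) = 0"
    using interval_relation_nonempty[of I L a] assms(1) compact convex by blast
  moreover have "L i \<noteq> {} \<longleftrightarrow> (\<exists>x\<in>K i. \<forall>j. j \<notin> insert s S \<longrightarrow> x j = y j)" for i
    by (auto simp: L_def H_def)
  ultimately show ?case by simp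
qed

text \<open>The hull of \<open>insert a X\<close> consists of the segments from \<open>a\<close> to
  the hull of \<open>X\<close>, so it is a continuous image of a compact product. Functions carry
  the product topology, hence continuity is checked coordinatewise.\<close>

lemma compact_convex_hull_finite_fun:
  fixes X :: "('a \<Rightarrow> real) set"
  assumes "finite X"
  shows "compact (convex hull X)"
  using assms
proof (induction X rule: finite_induct)
  case empty
  then show ?case by simp
next
  case (insert a X)
  show ?case
  proof (cases "X = {}")
    case True
    then show ?thesis by simp
  next
    case False
    let ?f = "\<lambda>(u :: real, b). (1 - u) *\<^sub>R a + u *\<^sub>R b"
    have "convex hull (insert a X) = ?f ` ({0..1} \<times> (convex hull X))"
    proof (intro equalityI subsetI)
      fix x assume "x \<in> convex hull (insert a X)"
      then obtain u v b where "0 \<le> u" "0 \<le> v" "u + v = 1" "b \<in> convex hull X" "x = u *\<^sub>R a + v *\<^sub>R b"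
        unfolding convex_hull_insert[OF False] by blast
      then have "u = 1 - v" "(v, b) \<in> {0..1} \<times> (convex hull X)" by auto
      then have "x = ?f (v, b)" "(v, b) \<in> {0..1} \<times> (convex hull X)"
        using \<open>x = u *\<^sub>R a + v *\<^sub>R b\<close> by auto
      then show "x \<in> ?f ` ({0..1} \<times> (convex hull X))" by blast
    next
      fix x assume "x \<in> ?f ` ({0..1} \<times> (convex hull X))"
      then obtain v b where "0 \<le> v" "v \<le> 1" "b \<in> convex hull X" "x = (1 - v) *\<^sub>R a + v *\<^sub>R b" by auto
      then show "x \<in> convex hull (insert a X)"
        using hull_mono[of X "insert a X"] hull_inc[of a "insert a X"]
        by (auto intro!: convexD[OF convex_convex_hull])
    qed
    moreover have "continuous_on ({0..1} \<times> (convex hull X)) ?f"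
    proof (rule continuous_on_coordinatewise_then_product)
      fix i
      have "continuous_on UNIV (\<lambda>p :: real \<times> ('a \<Rightarrow> real). snd p i)"
        using continuous_on_compose2[OF continuous_on_product_coordinates[of i] continuous_on_snd[OF continuous_on_id]]
        by simp
      then have "continuous_on ({0..1} \<times> (convex hull X)) (\<lambda>p :: real \<times> ('a \<Rightarrow> real). snd p i)"
        by (rule continuous_on_subset) simp
      then have "continuous_on ({0..1} \<times> (convex hull X)) (\<lambda>p. (1 - fst p) * a i + fst p * snd p i)"
        by (intro continuous_on_add continuous_on_mult continuous_on_diff continuous_on_const
            continuous_on_fst continuous_on_id)
      then show "continuous_on ({0..1} \<times> (convex hull X)) (\<lambda>p. ?f p i)"
        by (simp add: case_prod_unfold scaleR_fun_def)
    qed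
    ultimately show ?thesis
      using compact_continuous_image[OF _ compact_Times[OF compact_Icc insert.IH]] by simp
  qed
qed

section \<open>Polynomials\<close>

abbreviation polys :: "'v set \<Rightarrow> 'v rpoly set" where
  "polys V \<equiv> carrier (polynomial_ring V)"

lemma polynomial_ring_ops [simp]:
  "mult (polynomial_ring V) = (*)" "one (polynomial_ring V) = 1"
  "zero (polynomial_ring V) = 0" "add (polynomial_ring V) = (+)"
  by (simp_all add: polynomial_ring_def)

lemma polys_iff: "p \<in> polys V \<longleftrightarrow> (\<forall>m\<in>Poly_Mapping.keys p. Poly_Mapping.keys m \<subseteq> V)"
  by (simp add: polynomial_ring_def)

lemma polys_mono:
  assumes "V \<subseteq> W"
  shows "polys V \<subseteq> polys W"
proof
  fix p assume p: "p \<in> polys V"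
  show "p \<in> polys W"
    unfolding polys_iff
  proof
    fix m assume "m \<in> Poly_Mapping.keys p"
    then have "Poly_Mapping.keys m \<subseteq> V" using p by (simp add: polys_iff)
    then show "Poly_Mapping.keys m \<subseteq> W" using assms by simp
  qed
qed

lemma polys_zero [simp]: "0 \<in> polys V" and polys_one [simp]: "1 \<in> polys V"
  by (simp_all add: polys_iff)

lemma polys_add: "p \<in> polys V \<Longrightarrow> q \<in> polys V \<Longrightarrow> p + q \<in> polys V"
  and polys_mult: "p \<in> polys V \<Longrightarrow> q \<in> polys V \<Longrightarrow> p * q \<in> polys V"
  using cring.cring_simprules(1,5)[OF cring_polynomial_ring[of V]] by auto

lemma polys_uminus: "p \<in> polys V \<Longrightarrow> - p \<in> polys V"
  by (simp add: polys_iff in_keys_iff)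

lemma polys_diff: "p \<in> polys V \<Longrightarrow> q \<in> polys V \<Longrightarrow> p - q \<in> polys V"
  using polys_add[of p V "- q"] polys_uminus[of q V] by simp

lemma polys_sum: "(\<And>i. i \<in> I \<Longrightarrow> f i \<in> polys V) \<Longrightarrow> (\<Sum>i\<in>I. f i) \<in> polys V"
  by (induction I rule: infinite_finite_induct) (auto intro: polys_add)

lemma polys_prod: "(\<And>i. i \<in> I \<Longrightarrow> f i \<in> polys V) \<Longrightarrow> (\<Prod>i\<in>I. f i) \<in> polys V"
  by (induction I rule: infinite_finite_induct) (auto intro: polys_mult)

lemma polys_power: "p \<in> polys V \<Longrightarrow> p ^ k \<in> polys V"
  by (induction k) (auto intro: polys_mult)

lemma polys_single: "Poly_Mapping.keys m \<subseteq> V \<Longrightarrow> Poly_Mapping.single m c \<in> polys V"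
  by (simp add: polys_iff)

lemma polys_const [simp]: "poly_const c \<in> polys V"
  by (simp add: poly_const_def polys_single)

lemma polys_var: "v \<in> V \<Longrightarrow> poly_var v \<in> polys V"
  by (simp add: poly_var_def polys_single)

lemma polynomial_ring_minus:
  assumes "p \<in> polys V" "q \<in> polys V"
  shows "p \<ominus>\<^bsub>polynomial_ring V\<^esub> q = p - q"
proof -
  interpret cring "polynomial_ring V" by (rule cring_polynomial_ring)
  have "\<ominus>\<^bsub>polynomial_ring V\<^esub> q = - q"
    by (rule minus_equality) (use assms polys_uminus in auto)
  then show ?thesis by (simp add: a_minus_def)
qed

lemma finsum_polynomial_ring:
  "(\<And>i. i \<in> I \<Longrightarrow> f i \<in> polys V) \<Longrightarrow> finsum (polynomial_ring V) f I = (\<Sum>i\<in>I. f i)"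
proof (induction I rule: infinite_finite_induct)
  case (insert i I)
  interpret cring "polynomial_ring V" by (rule cring_polynomial_ring)
  show ?case using insert by (subst finsum_insert) auto
qed (auto simp: cring.cring_simprules finsum_def finprod_def)

lemma finprod_polynomial_ring:
  "(\<And>i. i \<in> I \<Longrightarrow> f i \<in> polys V) \<Longrightarrow> finprod (polynomial_ring V) f I = (\<Prod>i\<in>I. f i)"
proof (induction I rule: infinite_finite_induct)
  case (insert i I)
  interpret cring "polynomial_ring V" by (rule cring_polynomial_ring)
  show ?case using insert by (subst finprod_insert) auto
next
  case (infinite I)
  then show ?case by (simp add: finprod_def)
next
  case empty
  interpret cring "polynomial_ring V" by (rule cring_polynomial_ring)
  show ?case by simp
qed

lemma poly_expansion: "p = (\<Sum>m\<in>Poly_Mapping.keys p. Poly_Mapping.single m (Poly_Mapping.lookup p m))"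
proof (rule poly_mapping_eqI)
  fix k
  have "Poly_Mapping.lookup (\<Sum>m\<in>Poly_Mapping.keys p. Poly_Mapping.single m (Poly_Mapping.lookup p m)) k =
     (\<Sum>m\<in>Poly_Mapping.keys p. if m = k then Poly_Mapping.lookup p m else 0)"
    by (simp add: lookup_sum lookup_single when_def)
  also have "\<dots> = Poly_Mapping.lookup p k" by (simp add: in_keys_iff)
  finally show "Poly_Mapping.lookup p k =
    Poly_Mapping.lookup (\<Sum>m\<in>Poly_Mapping.keys p. Poly_Mapping.single m (Poly_Mapping.lookup p m)) k" ..
qed

subsection \<open>Homogeneous polynomials\<close>

definition monomial_mset :: "('v \<Rightarrow>\<^sub>0 nat) \<Rightarrow> 'v multiset" where
  "monomial_mset m = Abs_multiset (Poly_Mapping.lookup m)"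

lemma count_monomial_mset [simp]: "count (monomial_mset m) = Poly_Mapping.lookup m"
  unfolding monomial_mset_def by (rule count_Abs_multiset) simp

lemma monomial_mset_zero [simp]: "monomial_mset 0 = {#}"
  by (rule multiset_eqI) simp

lemma monomial_mset_plus [simp]: "monomial_mset (a + b) = monomial_mset a + monomial_mset b"
  by (rule multiset_eqI) (simp add: lookup_add)

lemma monomial_mset_single [simp]: "monomial_mset (Poly_Mapping.single v 1) = {#v#}"
  by (rule multiset_eqI) (simp add: lookup_single when_def)

lemma set_monomial_mset [simp]: "set_mset (monomial_mset m) = Poly_Mapping.keys m"
  by (auto simp: set_mset_def in_keys_iff)

lemma size_monomial_mset: "size (monomial_mset m) = (\<Sum>v\<in>Poly_Mapping.keys m. Poly_Mapping.lookup m v)"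
  by (simp add: size_multiset_overloaded_eq)

lemma homogeneous_iff: "homogeneous d p \<longleftrightarrow> (\<forall>m\<in>Poly_Mapping.keys p. size (monomial_mset m) = d)"
  by (simp add: homogeneous_def size_monomial_mset)

lemma homogeneous_zero [simp]: "homogeneous d 0"
  by (simp add: homogeneous_iff)

lemma homogeneous_single: "size (monomial_mset m) = d \<Longrightarrow> homogeneous d (Poly_Mapping.single m c)"
  by (simp add: homogeneous_iff)

lemma homogeneous_one: "homogeneous 0 1"
  by (simp add: homogeneous_iff)

lemma homogeneous_const: "homogeneous 0 (poly_const c)"
  by (simp add: poly_const_def homogeneous_single)

lemma homogeneous_var: "homogeneous 1 (poly_var v)"
  by (simp add: poly_var_def homogeneous_single del: One_nat_def)

lemma homogeneous_add: "homogeneous d p \<Longrightarrow> homogeneous d q \<Longrightarrow> homogeneous d (p + q)"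
  unfolding homogeneous_iff using Poly_Mapping.keys_add[of p q] by (meson UnE subsetD)

lemma homogeneous_uminus: "homogeneous d p \<Longrightarrow> homogeneous d (- p)"
  by (simp add: homogeneous_iff in_keys_iff)

lemma homogeneous_sum: "(\<And>i. i \<in> I \<Longrightarrow> homogeneous d (f i)) \<Longrightarrow> homogeneous d (\<Sum>i\<in>I. f i)"
  by (induction I rule: infinite_finite_induct) (auto intro: homogeneous_add)

lemma homogeneous_mult:
  assumes "homogeneous d p" "homogeneous e q"
  shows "homogeneous (d + e) (p * q)"
  unfolding homogeneous_iff
proof
  fix m assume "m \<in> Poly_Mapping.keys (p * q)"
  then obtain a b where "a \<in> Poly_Mapping.keys p" "b \<in> Poly_Mapping.keys q" "m = a + b"
    using Poly_Mapping.keys_mult[of p q] by blast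
  then show "size (monomial_mset m) = d + e" using assms by (simp add: homogeneous_iff)
qed

lemma homogeneous_power: "homogeneous d p \<Longrightarrow> homogeneous (k * d) (p ^ k)"
  by (induction k) (auto intro: homogeneous_mult homogeneous_one)

lemma homogeneous_prod:
  "(\<And>i. i \<in> I \<Longrightarrow> homogeneous (d i) (f i)) \<Longrightarrow> finite I \<Longrightarrow> homogeneous (\<Sum>i\<in>I. d i) (\<Prod>i\<in>I. f i)"
  by (induction I rule: infinite_finite_induct) (auto intro: homogeneous_mult homogeneous_one)

subsection \<open>Evaluation of polynomials\<close>

definition poly_value :: "'a set \<Rightarrow> 'a set set \<Rightarrow> 'a set rpoly \<Rightarrow> real" where
  "poly_value E M p =
     (\<Sum>m\<in>Poly_Mapping.keys p. Poly_Mapping.lookup p m * monomial_value E M (monomial_mset m) {#})"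

lemma poly_value_zero [simp]: "poly_value E M 0 = 0"
  by (simp add: poly_value_def)

lemma poly_value_single [simp]:
  "poly_value E M (Poly_Mapping.single m c) = c * monomial_value E M (monomial_mset m) {#}"
  by (simp add: poly_value_def)

lemma poly_value_add: "poly_value E M (p + q) = poly_value E M p + poly_value E M q"
  unfolding poly_value_def
  by (rule setsum_keys_plus_distrib) (auto simp: algebra_simps)

lemma poly_value_uminus: "poly_value E M (- p) = - poly_value E M p"
  using poly_value_add[of E M p "- p"] by simp

lemma poly_value_diff: "poly_value E M (p - q) = poly_value E M p - poly_value E M q"
  using poly_value_add[of E M p "- q"] by (simp add: poly_value_uminus)

lemma poly_value_sum: "poly_value E M (\<Sum>i\<in>I. f i) = (\<Sum>i\<in>I. poly_value E M (f i))"
  by (induction I rule: infinite_finite_induct) (auto simp: poly_value_add)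

lemma poly_value_const_mult: "poly_value E M (poly_const c * p) = c * poly_value E M p"
proof -
  have "poly_const c * p = (\<Sum>m\<in>Poly_Mapping.keys p. Poly_Mapping.single m (c * Poly_Mapping.lookup p m))"
    by (subst poly_expansion[of p]) (simp add: poly_const_def sum_distrib_left mult_single)
  then show ?thesis
    by (simp add: poly_value_sum poly_value_def[of E M p] sum_distrib_left mult.assoc)
qed

lemma poly_value_mult_expansion:
  "poly_value E M (q * p) =
     (\<Sum>m\<in>Poly_Mapping.keys q. Poly_Mapping.lookup q m * poly_value E M (Poly_Mapping.single m 1 * p))"
proof -
  have "q * p = (\<Sum>m\<in>Poly_Mapping.keys q.
      poly_const (Poly_Mapping.lookup q m) * (Poly_Mapping.single m 1 * p))"
    by (subst poly_expansion[of q])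
      (simp add: poly_const_def sum_distrib_right mult_single flip: mult.assoc)
  then show ?thesis by (simp add: poly_value_sum poly_value_const_mult)
qed

section \<open>Null polynomials and the Chow ideal\<close>

context finite_matroid
begin

text \<open>One variable for each nonempty proper subset, flat or not: this polynomial ring is
  shared by all matroids on \<open>E\<close>.\<close>

abbreviation subset_vars :: "'a set set" where
  "subset_vars \<equiv> {S. S \<noteq> {} \<and> S \<subset> E}"

lemma proper_flats_subset_vars: "proper_flats E M \<subseteq> subset_vars"
  by (auto simp: proper_flats_def flat_def)

text \<open>Quantifying over \<open>q\<close> makes the null polynomials an ideal.\<close>

definition null_poly :: "'a set rpoly \<Rightarrow> bool" where
  "null_poly p \<longleftrightarrow> p \<in> polys subset_vars \<and> (\<forall>q\<in>polys subset_vars. poly_value E M (q * p) = 0)"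

lemma null_polyI:
  assumes "p \<in> polys subset_vars"
    and "\<And>m. Poly_Mapping.keys m \<subseteq> subset_vars \<Longrightarrow> poly_value E M (Poly_Mapping.single m 1 * p) = 0"
  shows "null_poly p"
  unfolding null_poly_def
proof (intro conjI ballI assms(1))
  fix q assume "q \<in> polys subset_vars"
  then show "poly_value E M (q * p) = 0"
    unfolding poly_value_mult_expansion[of E M q p] polys_iff
    by (intro sum.neutral ballI) (simp add: assms(2))
qed

lemma null_poly_value:
  assumes "null_poly p"
  shows "poly_value E M p = 0"
proof -
  have "poly_value E M (1 * p) = 0" using assms polys_one unfolding null_poly_def by blast
  then show ?thesis by simp
qed

lemma null_poly_zero: "null_poly 0"
  by (simp add: null_poly_def)

lemma null_poly_add: "null_poly p \<Longrightarrow> null_poly q \<Longrightarrow> null_poly (p + q)"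
  by (auto simp: null_poly_def polys_add distrib_left poly_value_add)

lemma null_poly_uminus: "null_poly p \<Longrightarrow> null_poly (- p)"
  by (auto simp: null_poly_def polys_uminus poly_value_uminus)

lemma null_poly_mult:
  assumes "null_poly p" "q \<in> polys subset_vars"
  shows "null_poly (q * p)"
  unfolding null_poly_def
proof (intro conjI ballI)
  show "q * p \<in> polys subset_vars" using assms by (simp add: null_poly_def polys_mult)
  fix q' assume "q' \<in> polys subset_vars"
  then have "q' * q \<in> polys subset_vars" using assms(2) by (rule polys_mult)
  then have "poly_value E M (q' * q * p) = 0" using assms(1) by (simp add: null_poly_def)
  then show "poly_value E M (q' * (q * p)) = 0" by (simp add: mult.assoc)
qed

lemma null_poly_sum: "(\<And>i. i \<in> I \<Longrightarrow> null_poly (f i)) \<Longrightarrow> null_poly (\<Sum>i\<in>I. f i)"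
  by (induction I rule: infinite_finite_induct) (auto intro: null_poly_add null_poly_zero)

lemma null_poly_diff_mult:
  assumes "null_poly (p - p')" "null_poly (q - q')" "p \<in> polys subset_vars" "q' \<in> polys subset_vars"
  shows "null_poly (p * q - p' * q')"
proof -
  have "p * q - p' * q' = p * (q - q') + q' * (p - p')" by (simp add: algebra_simps)
  then show ?thesis using assms by (auto intro: null_poly_add null_poly_mult)
qed

lemma null_poly_diff_power:
  assumes "null_poly (p - q)" "p \<in> polys subset_vars" "q \<in> polys subset_vars"
  shows "null_poly (p ^ k - q ^ k)"
proof (induction k)
  case (Suc k)
  then show ?case
    using null_poly_diff_mult[OF assms(1) Suc assms(2) polys_power[OF assms(3)]] by simp
qed (simp add: null_poly_zero)

lemma null_poly_diff_prod:
  assumes "\<And>i. i \<in> I \<Longrightarrow> null_poly (f i - g i)"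
    "\<And>i. i \<in> I \<Longrightarrow> f i \<in> polys subset_vars" "\<And>i. i \<in> I \<Longrightarrow> g i \<in> polys subset_vars"
  shows "null_poly ((\<Prod>i\<in>I. f i) - (\<Prod>i\<in>I. g i))"
  using assms
proof (induction I rule: infinite_finite_induct)
  case (insert i I)
  have "null_poly (f i * prod f I - g i * prod g I)"
    by (rule null_poly_diff_mult) (use insert in \<open>auto intro: polys_prod\<close>)
  then show ?case using insert by simp
qed (simp_all add: null_poly_zero)

lemma poly_value_single_mult_var:
  "poly_value E M (Poly_Mapping.single m 1 * poly_var S) =
     monomial_value E M (add_mset S (monomial_mset m)) {#}"
  by (simp add: poly_var_def mult_single del: One_nat_def)

lemma null_poly_nonflat:
  assumes "S \<in> subset_vars" "S \<notin> proper_flats E M"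
  shows "null_poly (poly_var S)"
proof (rule null_polyI)
  fix m :: "'a set \<Rightarrow>\<^sub>0 nat" assume "Poly_Mapping.keys m \<subseteq> subset_vars"
  then have "{} \<notin># add_mset S (monomial_mset m)" using assms(1) by auto
  then show "poly_value E M (Poly_Mapping.single m 1 * poly_var S) = 0"
    unfolding poly_value_single_mult_var
    by (intro monomial_value_nonflat) (use assms in \<open>auto simp: proper_flats_def\<close>)
qed (rule polys_var[OF assms(1)])

lemma null_poly_incomparable:
  assumes "S \<in> subset_vars" "T \<in> subset_vars" "\<not> S \<subseteq> T" "\<not> T \<subseteq> S"
  shows "null_poly (poly_var S * poly_var T)"
proof (rule null_polyI)
  fix m :: "'a set \<Rightarrow>\<^sub>0 nat" assume m: "Poly_Mapping.keys m \<subseteq> subset_vars"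
  have "poly_value E M (Poly_Mapping.single m 1 * (poly_var S * poly_var T)) =
      monomial_value E M (add_mset S (add_mset T (monomial_mset m))) {#}"
    by (simp add: poly_var_def mult_single add_mset_commute del: One_nat_def)
  also have "\<dots> = 0"
    by (rule monomial_value_incomparable) (use assms m in auto)
  finally show "poly_value E M (Poly_Mapping.single m 1 * (poly_var S * poly_var T)) = 0" .
qed (use assms in \<open>auto intro: polys_mult polys_var\<close>)

text \<open>Nonflats may be added to the sum because their monomials have value zero; the full sum
  acts as \<open>h_E\<close>, independently of \<open>i\<close>.\<close>

lemma poly_value_mult_sum_containing:
  assumes "i \<in> E" "Poly_Mapping.keys m \<subseteq> subset_vars"
  shows "poly_value E M (Poly_Mapping.single m 1 * (\<Sum>F | F \<in> proper_flats E M \<and> i \<in> F. poly_var F)) =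
    monomial_value E M (monomial_mset m) {#E#}"
proof -
  have "(\<Sum>F | F \<in> proper_flats E M \<and> i \<in> F. monomial_value E M (add_mset F (monomial_mset m)) {#}) =
      (\<Sum>S | i \<in> S \<and> S \<subset> E. monomial_value E M (add_mset S (monomial_mset m)) {#})"
  proof (rule sum.mono_neutral_left)
    show "finite {S. i \<in> S \<and> S \<subset> E}"
      by (rule finite_subset[of _ "Pow E"]) (use finite_E in auto)
    show "{F. F \<in> proper_flats E M \<and> i \<in> F} \<subseteq> {S. i \<in> S \<and> S \<subset> E}"
      using proper_flats_subset_vars by auto
    show "\<forall>S\<in>{S. i \<in> S \<and> S \<subset> E} - {F. F \<in> proper_flats E M \<and> i \<in> F}.
        monomial_value E M (add_mset S (monomial_mset m)) {#} = 0"
    proof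
      fix S assume "S \<in> {S. i \<in> S \<and> S \<subset> E} - {F. F \<in> proper_flats E M \<and> i \<in> F}"
      then show "monomial_value E M (add_mset S (monomial_mset m)) {#} = 0"
        by (intro monomial_value_nonflat) (use assms(2) in \<open>auto simp: proper_flats_def\<close>)
    qed
  qed
  then show ?thesis
    using monomial_value_sum_containing[OF assms(1), of "monomial_mset m" "{#}"]
    by (simp add: sum_distrib_left poly_value_sum poly_value_single_mult_var)
qed

lemma chow_relations_polys: "chow_relations E M \<subseteq> polys (proper_flats E M)"
  unfolding chow_relations_def
  by (auto intro!: polys_mult polys_diff polys_sum polys_var)

lemma chow_relations_null: "p \<in> chow_relations E M \<Longrightarrow> null_poly p"
proof -
  assume p: "p \<in> chow_relations E M"
  then consider F1 F2 where "p = poly_var F1 * poly_var F2" "F1 \<in> proper_flats E M"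
      "F2 \<in> proper_flats E M" "\<not> F1 \<subseteq> F2" "\<not> F2 \<subseteq> F1"
    | i j where "i \<in> E" "j \<in> E" "p = (\<Sum>F | F \<in> proper_flats E M \<and> i \<in> F. poly_var F) -
        (\<Sum>F | F \<in> proper_flats E M \<and> j \<in> F. poly_var F)"
    unfolding chow_relations_def by blast
  then show ?thesis
  proof cases
    case 1
    then show ?thesis using proper_flats_subset_vars by (auto intro: null_poly_incomparable)
  next
    case 2
    have "p \<in> polys subset_vars"
      using p chow_relations_polys polys_mono[OF proper_flats_subset_vars] by blast
    then show ?thesis
      by (rule null_polyI)
        (simp add: 2 right_diff_distrib poly_value_diff poly_value_mult_sum_containing)
  qed
qed

sublocale flat_polys: cring "polynomial_ring (proper_flats E M)"
  by (rule cring_polynomial_ring)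

lemma ideal_chow_ideal: "ideal (chow_ideal E M) (polynomial_ring (proper_flats E M))"
  unfolding chow_ideal_def by (rule flat_polys.genideal_ideal[OF chow_relations_polys])

lemma chow_relations_subset_ideal: "chow_relations E M \<subseteq> chow_ideal E M"
  unfolding chow_ideal_def by (rule flat_polys.genideal_self[OF chow_relations_polys])

text \<open>The null polynomials in the flat variables form an ideal that contains the generators,
  hence the generated ideal; so \<open>poly_value\<close> descends to the Chow ring.\<close>

lemma chow_ideal_null: "p \<in> chow_ideal E M \<Longrightarrow> null_poly p"
proof -
  let ?R = "polynomial_ring (proper_flats E M)"
  have sub: "polys (proper_flats E M) \<subseteq> polys subset_vars"
    by (rule polys_mono[OF proper_flats_subset_vars])
  let ?N = "{p \<in> polys (proper_flats E M). null_poly p}"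
  have "ideal ?N ?R"
  proof (rule idealI)
    show "subgroup ?N (add_monoid ?R)"
    proof (rule group.subgroupI)
      show "group (add_monoid ?R)" by (rule flat_polys.a_group)
      show "?N \<noteq> {}" using null_poly_zero by auto
      fix a assume a: "a \<in> ?N"
      have "inv\<^bsub>add_monoid ?R\<^esub> a = - a"
        using a polys_uminus[of a] flat_polys.minus_equality[of "- a" a] by (simp add: a_inv_def)
      then show "inv\<^bsub>add_monoid ?R\<^esub> a \<in> ?N" using a polys_uminus null_poly_uminus by auto
    qed (auto intro: polys_add null_poly_add)
  next
    fix a x assume "a \<in> ?N" "x \<in> polys (proper_flats E M)"
    then have "x * a \<in> ?N" using sub by (auto intro: polys_mult null_poly_mult)
    then show "x \<otimes>\<^bsub>?R\<^esub> a \<in> ?N" "a \<otimes>\<^bsub>?R\<^esub> x \<in> ?N" by (simp_all add: mult.commute)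
  qed (rule flat_polys.ring_axioms)
  moreover have "chow_relations E M \<subseteq> ?N"
    using chow_relations_polys chow_relations_null by blast
  ultimately have "chow_ideal E M \<subseteq> ?N"
    unfolding chow_ideal_def by (rule flat_polys.genideal_minimal)
  then show "p \<in> chow_ideal E M \<Longrightarrow> null_poly p" by blast
qed

end

section \<open>The degree map\<close>

lemma prod_poly_var:
  "(\<Prod>i\<in>I. poly_var (F i)) = Poly_Mapping.single (\<Sum>i\<in>I. Poly_Mapping.single (F i) 1) 1"
  by (induction I rule: infinite_finite_induct) (simp_all add: poly_var_def mult_single del: One_nat_def)

lemma monomial_mset_sum_single:
  "finite I \<Longrightarrow> monomial_mset (\<Sum>i\<in>I. Poly_Mapping.single (F i) 1) = image_mset F (mset_set I)"
  by (induction I rule: finite_induct) (simp_all del: One_nat_def)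

lemma keys_plus_var:
  fixes m :: "'v \<Rightarrow>\<^sub>0 nat"
  shows "Poly_Mapping.keys (m + Poly_Mapping.single v 1) = insert v (Poly_Mapping.keys m)"
proof -
  have "set_mset (monomial_mset (m + Poly_Mapping.single v 1)) = insert v (set_mset (monomial_mset m))"
    by (simp del: One_nat_def set_monomial_mset)
  then show ?thesis by (simp only: set_monomial_mset)
qed

lemma monomial_split_var:
  fixes m :: "'v \<Rightarrow>\<^sub>0 nat"
  assumes "v \<in> Poly_Mapping.keys m"
  obtains m' where "m = m' + Poly_Mapping.single v 1" "Poly_Mapping.keys m - {v} \<subseteq> Poly_Mapping.keys m'"
    "Poly_Mapping.keys m' \<subseteq> Poly_Mapping.keys m" "Poly_Mapping.lookup m' v = Poly_Mapping.lookup m v - 1"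
proof
  let ?m' = "m - Poly_Mapping.single v 1"
  have v: "0 < Poly_Mapping.lookup m v" using assms by (simp add: in_keys_iff)
  have look: "Poly_Mapping.lookup ?m' w = (if w = v then Poly_Mapping.lookup m v - 1 else Poly_Mapping.lookup m w)" for w
    by (simp add: lookup_minus lookup_single when_def)
  show "m = ?m' + Poly_Mapping.single v 1"
    by (rule poly_mapping_eqI) (use v in \<open>auto simp: lookup_add look lookup_single when_def simp del: One_nat_def\<close>)
  show "Poly_Mapping.keys m - {v} \<subseteq> Poly_Mapping.keys ?m'"
    "Poly_Mapping.keys ?m' \<subseteq> Poly_Mapping.keys m"
    by (auto simp: in_keys_iff look simp del: One_nat_def split: if_splits)
  show "Poly_Mapping.lookup ?m' v = Poly_Mapping.lookup m v - 1" by (simp add: look del: One_nat_def)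
qed

section \<open>Chow classes of polynomials and existence of the degree map\<close>

context finite_matroid
begin

lemma chow_class_hom:
  "ring_hom_cring (polynomial_ring (proper_flats E M)) (chow_ring E M) (chow_class E M)"
proof -
  interpret ideal "chow_ideal E M" "polynomial_ring (proper_flats E M)" by (rule ideal_chow_ideal)
  have "chow_class E M = (+>\<^bsub>polynomial_ring (proper_flats E M)\<^esub>) (chow_ideal E M)"
    by (simp add: fun_eq_iff chow_class_def)
  then show ?thesis
    unfolding chow_ring_def using rcos_ring_hom_cring[OF cring_polynomial_ring] by simp
qed

lemma chow_class_eq_iff:
  assumes "p \<in> polys (proper_flats E M)" "q \<in> polys (proper_flats E M)"
  shows "chow_class E M p = chow_class E M q \<longleftrightarrow> p - q \<in> chow_ideal E M"
  unfolding chow_class_def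
  using flat_polys.quotient_eq_iff_same_a_r_cos[OF ideal_chow_ideal assms] polynomial_ring_minus[OF assms]
  by simp

lemma chow_class_add:
  assumes "p \<in> polys (proper_flats E M)" "q \<in> polys (proper_flats E M)"
  shows "chow_class E M p \<oplus>\<^bsub>chow_ring E M\<^esub> chow_class E M q = chow_class E M (p + q)"
proof -
  interpret h: ring_hom_cring "polynomial_ring (proper_flats E M)" "chow_ring E M" "chow_class E M"
    by (rule chow_class_hom)
  show ?thesis using h.hom_add[OF assms] by simp
qed

lemma chow_smult_class:
  assumes "p \<in> polys (proper_flats E M)"
  shows "chow_smult E M t (chow_class E M p) = chow_class E M (poly_const t * p)"
proof -
  interpret h: ring_hom_cring "polynomial_ring (proper_flats E M)" "chow_ring E M" "chow_class E M"
    by (rule chow_class_hom)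
  show ?thesis unfolding chow_smult_def using h.hom_mult[OF polys_const assms] by simp
qed

lemma chow_x_class:
  "chow_x E M S = chow_class E M (if S \<in> proper_flats E M then poly_var S else 0)"
proof -
  interpret h: ring_hom_cring "polynomial_ring (proper_flats E M)" "chow_ring E M" "chow_class E M"
    by (rule chow_class_hom)
  show ?thesis unfolding chow_x_def using h.hom_zero by simp
qed

lemma finsum_chow_class:
  assumes "\<And>i. i \<in> I \<Longrightarrow> f i \<in> polys (proper_flats E M)"
    and "\<And>i. i \<in> I \<Longrightarrow> g i = chow_class E M (f i)"
  shows "finsum (chow_ring E M) g I = chow_class E M (\<Sum>i\<in>I. f i)"
proof -
  interpret h: ring_hom_cring "polynomial_ring (proper_flats E M)" "chow_ring E M" "chow_class E M"
    by (rule chow_class_hom)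
  have "finsum (chow_ring E M) g I = finsum (chow_ring E M) (chow_class E M \<circ> f) I"
    by (rule h.S.finsum_cong') (use assms in auto)
  then show ?thesis
    using h.hom_finsum[of f I] finsum_polynomial_ring[of I f, OF assms(1)] assms(1)
    by (simp add: comp_def Pi_iff)
qed

lemma finprod_chow_class:
  assumes "\<And>i. i \<in> I \<Longrightarrow> f i \<in> polys (proper_flats E M)"
    and "\<And>i. i \<in> I \<Longrightarrow> g i = chow_class E M (f i)"
  shows "finprod (chow_ring E M) g I = chow_class E M (\<Prod>i\<in>I. f i)"
proof -
  interpret h: ring_hom_cring "polynomial_ring (proper_flats E M)" "chow_ring E M" "chow_class E M"
    by (rule chow_class_hom)
  have "finprod (chow_ring E M) g I = finprod (chow_ring E M) (chow_class E M \<circ> f) I"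
    by (rule h.S.finprod_cong') (use assms in auto)
  then show ?thesis
    using h.hom_finprod[of f I] finprod_polynomial_ring[of I f, OF assms(1)] assms(1)
    by (simp add: comp_def Pi_iff)
qed

lemma chow_class_power:
  assumes "p \<in> polys (proper_flats E M)"
  shows "chow_class E M p [^]\<^bsub>chow_ring E M\<^esub> (k::nat) = chow_class E M (p ^ k)"
proof -
  interpret h: ring_hom_cring "polynomial_ring (proper_flats E M)" "chow_ring E M" "chow_class E M"
    by (rule chow_class_hom)
  show ?thesis
  proof (induction k)
    case 0
    then show ?case using h.hom_one by simp
  next
    case (Suc k)
    then show ?case using h.hom_mult[OF polys_power[OF assms, of k] assms] by (simp add: mult.commute)
  qed
qed

lemma poly_value_class_cong:
  assumes "p \<in> polys (proper_flats E M)" "q \<in> polys (proper_flats E M)"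
    and "chow_class E M p = chow_class E M q"
  shows "poly_value E M p = poly_value E M q"
proof -
  have "null_poly (p - q)" using assms chow_class_eq_iff chow_ideal_null by blast
  then show ?thesis using null_poly_value poly_value_diff by (metis eq_iff_diff_eq_0)
qed

text \<open>The chosen representative may be inhomogeneous, which is harmless since all
  representatives of a class have the same value. The restriction provides the extensionality
  demanded in \<open>chow_deg\<close>.\<close>

definition degree_map :: "nat \<Rightarrow> 'a set rpoly set \<Rightarrow> real" where
  "degree_map r = restrict
     (\<lambda>a. poly_value E M (SOME p. p \<in> polys (proper_flats E M) \<and> chow_class E M p = a))
     (chow_graded E M r)"

lemma degree_map_class:
  assumes "p \<in> polys (proper_flats E M)" "homogeneous r p"
  shows "degree_map r (chow_class E M p) = poly_value E M p"
proof -
  let ?P = "\<lambda>q. q \<in> polys (proper_flats E M) \<and> chow_class E M q = chow_class E M p"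
  have "?P (SOME q. ?P q)" by (rule someI[of ?P p]) (use assms in simp)
  then have "poly_value E M (SOME q. ?P q) = poly_value E M p"
    using poly_value_class_cong assms(1) by blast
  moreover have "chow_class E M p \<in> chow_graded E M r"
    using assms by (auto simp: chow_graded_def)
  ultimately show ?thesis by (simp add: degree_map_def)
qed

lemma complete_flag_class:
  assumes "complete_flag E M r F"
  shows "finprod (chow_ring E M) (\<lambda>i. chow_x E M (F i)) {1..r} =
      chow_class E M (\<Prod>i=1..r. poly_var (F i))"
    and "(\<Prod>i=1..r. poly_var (F i)) \<in> polys (proper_flats E M)"
    and "homogeneous r (\<Prod>i=1..r. poly_var (F i))"
proof -
  have F: "F i \<in> proper_flats E M" if "i \<in> {1..r}" for i
    using assms that by (simp add: complete_flag_def)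
  show "finprod (chow_ring E M) (\<lambda>i. chow_x E M (F i)) {1..r} =
      chow_class E M (\<Prod>i=1..r. poly_var (F i))"
    by (rule finprod_chow_class) (use F in \<open>auto simp: chow_x_class intro: polys_var\<close>)
  show "(\<Prod>i=1..r. poly_var (F i)) \<in> polys (proper_flats E M)"
    by (intro polys_prod polys_var F)
  show "homogeneous r (\<Prod>i=1..r. poly_var (F i))"
    using homogeneous_prod[of "{1..r}" "\<lambda>_. 1" "\<lambda>i. poly_var (F i)", OF homogeneous_var] by simp
qed

lemma is_degree_map_degree_map:
  assumes "loopless E M" "rk E = r + 1"
  shows "is_degree_map E M r (degree_map r)"
  unfolding is_degree_map_def
proof (intro conjI ballI allI impI)
  fix a b assume "a \<in> chow_graded E M r" "b \<in> chow_graded E M r"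
  then obtain p q where "p \<in> polys (proper_flats E M)" "homogeneous r p" "a = chow_class E M p"
    "q \<in> polys (proper_flats E M)" "homogeneous r q" "b = chow_class E M q"
    by (auto simp: chow_graded_def)
  then show "degree_map r (a \<oplus>\<^bsub>chow_ring E M\<^esub> b) = degree_map r a + degree_map r b"
    by (simp add: chow_class_add degree_map_class polys_add homogeneous_add poly_value_add)
next
  fix t a assume "a \<in> chow_graded E M r"
  then obtain p where p: "p \<in> polys (proper_flats E M)" "homogeneous r p" "a = chow_class E M p"
    by (auto simp: chow_graded_def)
  have "homogeneous r (poly_const t * p)"
    using homogeneous_mult[OF homogeneous_const p(2)] by simp
  then show "degree_map r (chow_smult E M t a) = t * degree_map r a"
    using p by (simp add: chow_smult_class degree_map_class polys_mult poly_value_const_mult)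
next
  fix F assume F: "complete_flag E M r F"
  have "degree_map r (finprod (chow_ring E M) (\<lambda>i. chow_x E M (F i)) {1..r}) =
      poly_value E M (\<Prod>i=1..r. poly_var (F i))"
    using complete_flag_class[OF F] degree_map_class by simp
  also have "\<dots> = monomial_value E M (image_mset F (mset_set {1..r})) {#}"
    unfolding prod_poly_var poly_value_single monomial_mset_sum_single[OF finite_atLeastAtMost] by simp
  also have "\<dots> = 1" by (rule monomial_value_flag[OF assms F])
  finally show "degree_map r (finprod (chow_ring E M) (\<lambda>i. chow_x E M (F i)) {1..r}) = 1" .
qed

section \<open>Complete flags span the top degree; uniqueness of the degree map\<close>

lemma monomial_incomparable_in_ideal:
  assumes "Poly_Mapping.keys m \<subseteq> proper_flats E M" "F \<in> Poly_Mapping.keys m"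
    "G \<in> Poly_Mapping.keys m" "\<not> F \<subseteq> G" "\<not> G \<subseteq> F"
  shows "Poly_Mapping.single m 1 \<in> chow_ideal E M"
proof -
  obtain m1 where m1: "m = m1 + Poly_Mapping.single F 1" "Poly_Mapping.keys m - {F} \<subseteq> Poly_Mapping.keys m1"
    "Poly_Mapping.keys m1 \<subseteq> Poly_Mapping.keys m"
    using monomial_split_var[OF assms(2)] by metis
  then have "G \<in> Poly_Mapping.keys m1" using assms by blast
  then obtain m2 where m2: "m1 = m2 + Poly_Mapping.single G 1" "Poly_Mapping.keys m2 \<subseteq> Poly_Mapping.keys m1"
    using monomial_split_var by metis
  have "Poly_Mapping.single m2 1 \<in> polys (proper_flats E M)"
    by (rule polys_single) (use m1 m2 assms in blast)
  moreover have "poly_var F * poly_var G \<in> chow_ideal E M"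
    using assms chow_relations_subset_ideal unfolding chow_relations_def by blast
  ultimately have "Poly_Mapping.single m2 1 * (poly_var F * poly_var G) \<in> chow_ideal E M"
    using ideal.I_l_closed[OF ideal_chow_ideal] by simp
  moreover have "Poly_Mapping.single m2 1 * (poly_var F * poly_var G) = Poly_Mapping.single m 1"
    unfolding m1(1) m2(1) poly_var_def by (simp add: mult_single ac_simps)
  ultimately show ?thesis by simp
qed

text \<open>Take \<open>i\<close> in \<open>F\<close> outside the largest member below
  \<open>F\<close>, and \<open>j\<close> outside \<open>F\<close> in the smallest member above it,
  or arbitrary if there is no such member. Members below \<open>F\<close> then contain neither,
  members above contain both.\<close>

lemma chain_separating_elements:
  assumes "finite K" "K \<subseteq> proper_flats E M" "F \<in> K" "\<And>G H. G \<in> K \<Longrightarrow> H \<in> K \<Longrightarrow> G \<subseteq> H \<or> H \<subseteq> G"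
  obtains i j where "i \<in> F" "j \<in> E - F" "\<And>G. G \<in> K \<Longrightarrow> G \<noteq> F \<Longrightarrow> i \<in> G \<longleftrightarrow> j \<in> G"
proof -
  have F: "F \<noteq> {}" "F \<subset> E" using assms by (auto simp: proper_flats_def flat_def)
  have "\<exists>i\<in>F. \<forall>G\<in>K. G \<subset> F \<longrightarrow> i \<notin> G"
  proof (cases "{G \<in> K. G \<subset> F} = {}")
    case True
    then show ?thesis using F by blast
  next
    case False
    have "finite {G \<in> K. G \<subset> F}" using assms(1) by simp
    from finite_has_maximal[OF this False]
    obtain H where H0: "H \<in> {G \<in> K. G \<subset> F}" "\<forall>G\<in>{G \<in> K. G \<subset> F}. H \<le> G \<longrightarrow> H = G" ..
    then have H: "H \<in> K" "H \<subset> F" "\<And>G. G \<in> K \<Longrightarrow> G \<subset> F \<Longrightarrow> H \<subseteq> G \<Longrightarrow> H = G" by simp_all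
    then obtain i where "i \<in> F" "i \<notin> H" by blast
    moreover have "G \<subseteq> H" if "G \<in> K" "G \<subset> F" for G using assms(4)[OF that(1) H(1)] H(3)[OF that] by blast
    ultimately show ?thesis by blast
  qed
  then obtain i where i: "i \<in> F" "\<And>G. G \<in> K \<Longrightarrow> G \<subset> F \<Longrightarrow> i \<notin> G" by blast
  have "\<exists>j\<in>E - F. \<forall>G\<in>K. F \<subset> G \<longrightarrow> j \<in> G"
  proof (cases "{G \<in> K. F \<subset> G} = {}")
    case True
    then show ?thesis using F by blast
  next
    case False
    have "finite {G \<in> K. F \<subset> G}" using assms(1) by simp
    from finite_has_minimal[OF this False]
    obtain H where H0: "H \<in> {G \<in> K. F \<subset> G}" "\<forall>G\<in>{G \<in> K. F \<subset> G}. G \<le> H \<longrightarrow> H = G" ..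
    then have H: "H \<in> K" "F \<subset> H" "\<And>G. G \<in> K \<Longrightarrow> F \<subset> G \<Longrightarrow> G \<subseteq> H \<Longrightarrow> H = G" by simp_all
    moreover have "H \<subseteq> E" using H(1) assms(2) by (auto simp: proper_flats_def flat_def)
    ultimately obtain j where "j \<in> E - F" "j \<in> H" by blast
    moreover have "H \<subseteq> G" if "G \<in> K" "F \<subset> G" for G using assms(4)[OF that(1) H(1)] H(3)[OF that] by blast
    ultimately show ?thesis by blast
  qed
  then obtain j where j: "j \<in> E - F" "\<And>G. G \<in> K \<Longrightarrow> F \<subset> G \<Longrightarrow> j \<in> G" by blast
  have "i \<in> G \<longleftrightarrow> j \<in> G" if "G \<in> K" "G \<noteq> F" for G
    using assms(4)[OF that(1) assms(3)] i j that by blast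
  then show ?thesis using that i(1) j(1) by blast
qed

text \<open>The rank is injective on the chain with values in \<open>{1..r}\<close>, so with
  \<open>r\<close> members it is a bijection, and its inverse enumerates the flag.\<close>

lemma squarefree_chain_is_flag:
  assumes "loopless E M" "rk E = r + 1" "K \<subseteq> proper_flats E M" "card K = r"
    and "\<And>G H. G \<in> K \<Longrightarrow> H \<in> K \<Longrightarrow> G \<subseteq> H \<or> H \<subseteq> G"
  obtains F where "complete_flag E M r F" "bij_betw F {1..r} K"
proof -
  have flats: "flat E M G" "G \<noteq> {}" "G \<subseteq> E" "rk G < rk E" if "G \<in> K" for G
  proof -
    have "G \<in> proper_flats E M" using that assms(3) by blast
    then show "flat E M G" "G \<noteq> {}" "G \<subseteq> E" "rk G < rk E"
      using proper_flat_rank_less by (auto simp: proper_flats_def flat_def)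
  qed
  have less: "rk G < rk H" if "G \<in> K" "H \<in> K" "G \<subset> H" for G H
    using flat_rank_less flats that by blast
  have inj: "inj_on rk K"
  proof (rule inj_onI)
    fix G H assume "G \<in> K" "H \<in> K" "rk G = rk H"
    then show "G = H" using assms(5)[of G H] less[of G H] less[of H G] by auto
  qed
  have "rk ` K \<subseteq> {1..r}"
  proof
    fix k assume "k \<in> rk ` K"
    then obtain G where G: "G \<in> K" "k = rk G" by blast
    then obtain i where i: "i \<in> G" "i \<in> E" using flats[of G] by blast
    have "rk {i} \<le> rk G" by (rule rank_mono) (use i in auto)
    then show "k \<in> {1..r}" using assms(1,2) flats(4)[OF G(1)] G i by (auto simp: loopless_def)
  qed
  moreover have "card (rk ` K) = card {1..r}" using card_image[OF inj] assms(4) by simp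
  ultimately have bij: "bij_betw rk K {1..r}"
    using inj by (simp add: bij_betw_def card_subset_eq)
  define F where "F = inv_into K rk"
  have bijF: "bij_betw F {1..r} K" unfolding F_def using bij by (rule bij_betw_inv_into)
  have F: "F i \<in> K" "rk (F i) = i" if "i \<in> {1..r}" for i
    using that bij bij_betwE[OF bijF] by (auto simp: F_def bij_betw_inv_into_right)
  have "complete_flag E M r F"
    unfolding complete_flag_def
  proof (intro conjI ballI)
    fix i assume i: "i \<in> {1..<r}"
    then have *: "F i \<in> K" "F (Suc i) \<in> K" "rk (F i) < rk (F (Suc i))" using F by auto
    then have "\<not> F (Suc i) \<subseteq> F i" using rank_mono[of "F (Suc i)" "F i"] by auto
    then show "F i \<subset> F (Suc i)" using assms(5)[OF *(1,2)] by blast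
  qed (use F assms(3) in blast)
  then show ?thesis using that bijF by blast
qed

text \<open>If \<open>x\<^sub>F\<^sup>2\<close> divides a monomial, a linear relation with suitable \<open>i \<in> F\<close> and \<open>j \<notin> F\<close> replaces one
  factor \<open>x\<^sub>F\<close> by variables outside the support, so the support grows until it is a complete flag.\<close>

lemma degree_functional_eq_0:
  fixes d :: "'a set rpoly \<Rightarrow> real"
  assumes "loopless E M" "rk E = r + 1"
    and add: "\<And>p q. p \<in> polys (proper_flats E M) \<Longrightarrow> homogeneous r p \<Longrightarrow>
      q \<in> polys (proper_flats E M) \<Longrightarrow> homogeneous r q \<Longrightarrow> d (p + q) = d p + d q"
    and smult: "\<And>t p. p \<in> polys (proper_flats E M) \<Longrightarrow> homogeneous r p \<Longrightarrow>
      d (poly_const t * p) = t * d p"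
    and ideal: "\<And>p. p \<in> chow_ideal E M \<Longrightarrow> homogeneous r p \<Longrightarrow> d p = 0"
    and flag: "\<And>F. complete_flag E M r F \<Longrightarrow> d (\<Prod>i=1..r. poly_var (F i)) = 0"
    and p: "p \<in> polys (proper_flats E M)" "homogeneous r p"
  shows "d p = 0"
proof -
  have d0: "d 0 = 0" using smult[of 0 0] by simp
  have d_sum: "d (\<Sum>i\<in>I. f i) = (\<Sum>i\<in>I. d (f i))"
    if "\<And>i. i \<in> I \<Longrightarrow> f i \<in> polys (proper_flats E M)" "\<And>i. i \<in> I \<Longrightarrow> homogeneous r (f i)"
    for I and f :: "'c \<Rightarrow> 'a set rpoly"
    using that
    by (induction I rule: infinite_finite_induct)
      (simp_all add: d0 add polys_sum homogeneous_sum)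
  have monomial: "d (Poly_Mapping.single m 1) = 0"
    if "Poly_Mapping.keys m \<subseteq> proper_flats E M" "size (monomial_mset m) = r" for m
    using that
  \<comment> \<open>The measure is the number of flats outside the support; each replacement
    enlarges the support.\<close>
  proof (induction "card (proper_flats E M) - card (Poly_Mapping.keys m)" arbitrary: m rule: less_induct)
    case less
    note keys = less.prems(1) and deg = less.prems(2)
    show ?case
    proof (cases "\<forall>G\<in>Poly_Mapping.keys m. \<forall>H\<in>Poly_Mapping.keys m. G \<subseteq> H \<or> H \<subseteq> G")
      case False
      then show ?thesis
        using monomial_incomparable_in_ideal[OF keys] ideal homogeneous_single[OF deg] by blast
    next
      case chain: True
      show ?thesis
      proof (cases "\<exists>F\<in>Poly_Mapping.keys m. 2 \<le> Poly_Mapping.lookup m F")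
        case False
        then have one: "Poly_Mapping.lookup m F = 1" if "F \<in> Poly_Mapping.keys m" for F
        proof -
          have "Poly_Mapping.lookup m F \<noteq> 0" "\<not> 2 \<le> Poly_Mapping.lookup m F"
            using that False by (simp_all add: in_keys_iff)
          then show ?thesis by linarith
        qed
        then have "card (Poly_Mapping.keys m) = r"
          using deg by (simp add: size_monomial_mset)
        then obtain F where F: "complete_flag E M r F" "bij_betw F {1..r} (Poly_Mapping.keys m)"
          using squarefree_chain_is_flag[OF assms(1,2) keys] chain by blast
        have "(\<Sum>i=1..r. Poly_Mapping.single (F i) 1) = (\<Sum>G\<in>Poly_Mapping.keys m. Poly_Mapping.single G 1)"
          by (rule sum.reindex_bij_betw[OF F(2)])
        also have "\<dots> = m" by (subst (2) poly_expansion[of m]) (simp add: one)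
        finally show ?thesis using flag[OF F(1)] by (simp add: prod_poly_var)
      next
        case True
        then obtain F where F: "F \<in> Poly_Mapping.keys m" "2 \<le> Poly_Mapping.lookup m F" by blast
        obtain m' where m': "m = m' + Poly_Mapping.single F 1" "Poly_Mapping.keys m - {F} \<subseteq> Poly_Mapping.keys m'"
          "Poly_Mapping.keys m' \<subseteq> Poly_Mapping.keys m" "Poly_Mapping.lookup m' F = Poly_Mapping.lookup m F - 1"
          using monomial_split_var[OF F(1)] by metis
        \<comment> \<open>The exponent of \<open>F\<close> is at least two, so \<open>F\<close>
          stays in the support after one factor is split off.\<close>
        then have keys': "Poly_Mapping.keys m' = Poly_Mapping.keys m"
          using F by (auto simp: in_keys_iff)
        obtain i j where ij: "i \<in> F" "j \<in> E - F"
          "\<And>G. G \<in> Poly_Mapping.keys m \<Longrightarrow> G \<noteq> F \<Longrightarrow> i \<in> G \<longleftrightarrow> j \<in> G"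
          using chain_separating_elements[OF finite_keys keys F(1)] chain by blast
        have iE: "i \<in> E" using ij F keys by (auto simp: proper_flats_def flat_def)
        define t where "t G = Poly_Mapping.single (m' + Poly_Mapping.single G 1) (1 :: real)" for G
        have t: "t G \<in> polys (proper_flats E M)" "homogeneous r (t G)" if "G \<in> proper_flats E M" for G
          unfolding t_def
          by (rule polys_single; use keys' keys that keys_add[of m' "Poly_Mapping.single G 1"] in fastforce)
            (rule homogeneous_single; use deg m'(1) in \<open>simp del: One_nat_def\<close>)
        have tG: "d (t G) = 0" if "G \<in> proper_flats E M" "G \<notin> Poly_Mapping.keys m" for G
          unfolding t_def
        proof (rule less.hyps)
          have k: "Poly_Mapping.keys (m' + Poly_Mapping.single G 1) = insert G (Poly_Mapping.keys m)"
            unfolding keys_plus_var keys' ..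
          show "Poly_Mapping.keys (m' + Poly_Mapping.single G 1) \<subseteq> proper_flats E M"
            using k keys that by simp
          then have "card (insert G (Poly_Mapping.keys m)) \<le> card (proper_flats E M)"
            unfolding k by (rule card_mono[OF finite_proper_flats])
          then show "card (proper_flats E M) - card (Poly_Mapping.keys (m' + Poly_Mapping.single G 1)) <
              card (proper_flats E M) - card (Poly_Mapping.keys m)"
            unfolding k using that by simp
          show "size (monomial_mset (m' + Poly_Mapping.single G 1)) = r"
            using deg m'(1) by (simp del: One_nat_def)
        qed
        let ?S = "\<lambda>i. \<Sum>G | G \<in> proper_flats E M \<and> i \<in> G. poly_var G"
        have St: "Poly_Mapping.single m' 1 * ?S k = (\<Sum>G | G \<in> proper_flats E M \<and> k \<in> G. t G)" for k
          by (simp add: sum_distrib_left poly_var_def mult_single t_def)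
        have "?S i - ?S j \<in> chow_ideal E M"
          using chow_relations_subset_ideal iE ij(2) unfolding chow_relations_def by blast
        then have "Poly_Mapping.single m' 1 * (?S i - ?S j) \<in> chow_ideal E M"
          using ideal.I_l_closed[OF ideal_chow_ideal] polys_single[of m' "proper_flats E M" 1] keys keys' by simp
        then have inI: "(\<Sum>G | G \<in> proper_flats E M \<and> i \<in> G. t G) - (\<Sum>G | G \<in> proper_flats E M \<and> j \<in> G. t G)
            \<in> chow_ideal E M"
          by (simp add: right_diff_distrib St)
        have sums: "(\<Sum>G | G \<in> proper_flats E M \<and> k \<in> G. t G) \<in> polys (proper_flats E M)"
          "homogeneous r (\<Sum>G | G \<in> proper_flats E M \<and> k \<in> G. t G)"
          "d (\<Sum>G | G \<in> proper_flats E M \<and> k \<in> G. t G) = (\<Sum>G | G \<in> proper_flats E M \<and> k \<in> G. d (t G))" for k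
          using t by (auto intro!: polys_sum homogeneous_sum d_sum)
        \<comment> \<open>\<open>d\<close> is only known to be additive and compatible with scalars,
          so differences go through the scalar \<open>-1\<close>.\<close>
        have neg: "- q = poly_const (-1) * q" for q :: "'a set rpoly"
          by (simp add: poly_const_def single_uminus)
        have d_diff: "d (p - q) = d p - d q"
          if "p \<in> polys (proper_flats E M)" "homogeneous r p" "q \<in> polys (proper_flats E M)" "homogeneous r q" for p q
          using add[of p "- q"] smult[of q "-1"] that polys_uminus[of q] homogeneous_uminus[of r q]
          by (simp flip: neg)
        have "homogeneous r ((\<Sum>G | G \<in> proper_flats E M \<and> i \<in> G. t G) - (\<Sum>G | G \<in> proper_flats E M \<and> j \<in> G. t G))"
          using homogeneous_add[OF sums(2)[of i] homogeneous_uminus[OF sums(2)[of j]]] by simp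
        then have "(\<Sum>G | G \<in> proper_flats E M \<and> i \<in> G. d (t G)) = (\<Sum>G | G \<in> proper_flats E M \<and> j \<in> G. d (t G))"
          using ideal[OF inI] d_diff[OF sums(1,2)[of i] sums(1,2)[of j]] sums(3) by simp
        moreover have "(\<Sum>G | G \<in> proper_flats E M \<and> k \<in> G. d (t G)) =
            (\<Sum>G\<in>proper_flats E M. if k \<in> G then d (t G) else 0)" for k
          using finite_proper_flats by (simp add: sum.inter_filter)
        ultimately have "0 = (\<Sum>G\<in>proper_flats E M. (if i \<in> G then d (t G) else 0) - (if j \<in> G then d (t G) else 0))"
          by (simp add: sum_subtractf)
        \<comment> \<open>Flats outside the support contribute zero by induction, and flats of the
          support other than \<open>F\<close> contain both or neither of \<open>i\<close> and
          \<open>j\<close>.\<close>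
        also have "\<dots> = (\<Sum>G\<in>{F}. (if i \<in> G then d (t G) else 0) - (if j \<in> G then d (t G) else 0))"
        proof (rule sum.mono_neutral_right[OF finite_proper_flats])
          show "{F} \<subseteq> proper_flats E M" using F keys by blast
          show "\<forall>G\<in>proper_flats E M - {F}. (if i \<in> G then d (t G) else 0) - (if j \<in> G then d (t G) else 0) = 0"
          proof
            fix G assume "G \<in> proper_flats E M - {F}"
            then show "(if i \<in> G then d (t G) else 0) - (if j \<in> G then d (t G) else 0) = 0"
              using ij(3)[of G] tG[of G] by (cases "G \<in> Poly_Mapping.keys m") auto
          qed
        qed
        also have "\<dots> = d (t F)" using ij by simp
        also have "t F = Poly_Mapping.single m 1" by (simp add: t_def m'(1))
        finally show ?thesis by simp
      qed
    qed
  qed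
  have mono: "Poly_Mapping.single m 1 \<in> polys (proper_flats E M)" "homogeneous r (Poly_Mapping.single m (1::real))"
    "d (Poly_Mapping.single m 1) = 0"
    if "m \<in> Poly_Mapping.keys p" for m
    using that p monomial by (auto simp: polys_iff homogeneous_iff)
  have "p = (\<Sum>m\<in>Poly_Mapping.keys p. poly_const (Poly_Mapping.lookup p m) * Poly_Mapping.single m 1)"
    by (subst poly_expansion[of p]) (simp add: poly_const_def mult_single)
  moreover have "homogeneous r (poly_const c * Poly_Mapping.single m 1)" if "m \<in> Poly_Mapping.keys p" for c m
    using homogeneous_mult[OF homogeneous_const mono(2)[OF that]] by simp
  ultimately have "d p = (\<Sum>m\<in>Poly_Mapping.keys p. d (poly_const (Poly_Mapping.lookup p m) * Poly_Mapping.single m 1))"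
    using d_sum[of "Poly_Mapping.keys p" "\<lambda>m. poly_const (Poly_Mapping.lookup p m) * Poly_Mapping.single m 1"]
      polys_mult[OF polys_const mono(1)] by simp
  also have "\<dots> = 0"
    by (rule sum.neutral) (use mono smult in auto)
  finally show ?thesis .
qed

text \<open>The difference of two degree maps, viewed on polynomials, kills the ideal and takes the
  value \<open>1 - 1\<close> on complete flags, so \<open>degree_functional_eq_0\<close>
  applies.\<close>

lemma degree_map_unique:
  assumes "loopless E M" "rk E = r + 1"
    and "f \<in> extensional (chow_graded E M r)" "is_degree_map E M r f"
    and "g \<in> extensional (chow_graded E M r)" "is_degree_map E M r g"
  shows "f = g"
proof (rule extensionalityI[OF assms(3,5)])
  fix a assume "a \<in> chow_graded E M r"
  then obtain p where p: "p \<in> polys (proper_flats E M)" "homogeneous r p" "a = chow_class E M p"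
    by (auto simp: chow_graded_def)
  have graded: "chow_class E M q \<in> chow_graded E M r"
    if "q \<in> polys (proper_flats E M)" "homogeneous r q" for q
    using that by (auto simp: chow_graded_def)
  have add: "h (chow_class E M (q + q')) = h (chow_class E M q) + h (chow_class E M q')"
    if "is_degree_map E M r h" "q \<in> polys (proper_flats E M)" "homogeneous r q"
      "q' \<in> polys (proper_flats E M)" "homogeneous r q'" for h q q'
    using that graded[of q] graded[of q'] unfolding is_degree_map_def by (simp flip: chow_class_add)
  have smult: "h (chow_class E M (poly_const t * q)) = t * h (chow_class E M q)"
    if "is_degree_map E M r h" "q \<in> polys (proper_flats E M)" "homogeneous r q" for h q t
    using that graded[of q] unfolding is_degree_map_def by (simp flip: chow_smult_class)
  have flag: "h (chow_class E M (\<Prod>i=1..r. poly_var (F i))) = 1"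
    if "is_degree_map E M r h" "complete_flag E M r F" for h F
    using that unfolding is_degree_map_def complete_flag_class(1)[OF that(2), symmetric] by blast
  have "f (chow_class E M p) - g (chow_class E M p) = 0"
  proof (rule degree_functional_eq_0[OF assms(1,2), where d = "\<lambda>p. f (chow_class E M p) - g (chow_class E M p)"])
    fix q assume q: "q \<in> chow_ideal E M" "homogeneous r q"
    then have "q \<in> polys (proper_flats E M)"
      using ideal.Icarr[OF ideal_chow_ideal] by blast
    then have "chow_class E M q = chow_class E M 0" using q chow_class_eq_iff[of q 0] by simp
    moreover have "f (chow_class E M 0) = 0" "g (chow_class E M 0) = 0"
      using smult[OF assms(4), of 0 0] smult[OF assms(6), of 0 0] by simp_all
    ultimately show "f (chow_class E M q) - g (chow_class E M q) = 0" by simp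
  qed (use add[OF assms(4)] add[OF assms(6)] smult[OF assms(4)] smult[OF assms(6)]
      flag[OF assms(4)] flag[OF assms(6)] p in \<open>auto simp: algebra_simps\<close>)
  then show "f a = g a" using p(3) by simp
qed

text \<open>Existence and uniqueness identify the description in \<open>chow_deg\<close> with
  \<open>degree_map r\<close>; as the rank is \<open>r + 1\<close>, the truncated subtraction there
  gives \<open>r\<close>.\<close>

lemma chow_deg_class:
  assumes "loopless E M" "rk E = r + 1" "p \<in> polys (proper_flats E M)" "homogeneous r p"
  shows "chow_deg E M (chow_class E M p) = poly_value E M p"
proof -
  have r: "rk E - 1 = r" using assms(2) by simp
  have ext: "degree_map r \<in> extensional (chow_graded E M r)" by (simp add: degree_map_def)
  have "chow_deg E M = degree_map r"
    unfolding chow_deg_def Let_def r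
    by (rule the_equality)
      (use ext is_degree_map_degree_map[OF assms(1,2)] degree_map_unique[OF assms(1,2)] in auto)
  then show ?thesis using degree_map_class[OF assms(3,4)] by simp
qed

end

section \<open>Valuativity\<close>

lemma finite_matroidI: "matroid E M \<Longrightarrow> finite_matroid E M"
  by (rule finite_matroid.intro)

text \<open>Ensures that fixing the coordinates outside \<open>E\<close> at zero cuts nothing off
  the polytope.\<close>

lemma matroid_polytope_support:
  assumes "matroid E M" "x \<in> matroid_polytope M" "j \<notin> E"
  shows "x j = 0"
proof -
  have base: "j \<notin> B" if "B \<in> M" for B
    using assms(1,3) that unfolding matroid_def by blast
  have "convex {x :: 'a \<Rightarrow> real. x j = 0}"
    by (rule convexI) (auto simp: scaleR_fun_def)
  then have "matroid_polytope M \<subseteq> {x. x j = 0}"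
    unfolding matroid_polytope_def
    by (intro hull_minimal) (use base in auto)
  then show ?thesis using assms(2) by blast
qed

section \<open>Transfer of a relation between polytope indicators to values of polynomials\<close>

context
  fixes I :: "'i set" and E :: "'a set" and M :: "'i \<Rightarrow> 'a set set" and a :: "'i \<Rightarrow> int"
  assumes fin: "finite I" and mat: "\<And>i. i \<in> I \<Longrightarrow> matroid E (M i)" and nonempty: "E \<noteq> {}"
    and rel: "\<And>x. (\<Sum>i\<in>I. a i * indicator (matroid_polytope (M i)) x) = 0"
begin

lemma dragon_relation:
  assumes "{} \<notin># C" "\<And>A. A \<in># C \<Longrightarrow> A \<subseteq> E"
  shows "(\<Sum>i\<in>I. a i * of_bool (dragon E (M i) C)) = 0"
proof (cases "I = {}")
  case False
  then have "finite E" using mat by (auto simp: matroid_def)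
  define K where "K i = matroid_polytope (M i) \<inter> dragon_polyhedron E C" for i
  have "compact (K i)" "convex (K i)" if "i \<in> I" for i
  proof -
    interpret finite_matroid E "M i" by (rule finite_matroidI[OF mat[OF that]])
    show "compact (K i)"
      unfolding K_def matroid_polytope_def
      by (intro compact_Int_closed compact_convex_hull_finite_fun closed_dragon_polyhedron finite_imageI finite_bases)
    show "convex (K i)"
      unfolding K_def matroid_polytope_def
      by (intro convex_Int convex_convex_hull convex_dragon_polyhedron)
  qed
  \<comment> \<open>The given relation is multiplied by the indicator of the polyhedron.\<close>
  moreover have "(\<Sum>i\<in>I. a i * of_bool (x \<in> K i)) = 0" for x
  proof (cases "x \<in> dragon_polyhedron E C")
    case True
    then show ?thesis using rel[of x] by (simp add: K_def indicator_def)
  qed (simp add: K_def)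
  \<comment> \<open>All coordinates in \<open>E\<close> are free and \<open>y\<close> is zero, so
    the fiber is the whole of \<open>K i\<close> and only its nonemptiness is counted.\<close>
  ultimately have "(\<Sum>i\<in>I. a i * of_bool (\<exists>x\<in>K i. \<forall>j. j \<notin> E \<longrightarrow> x j = 0)) = 0"
    using fin \<open>finite E\<close> by (intro convex_relation_fiber)
  moreover have "(\<exists>x\<in>K i. \<forall>j. j \<notin> E \<longrightarrow> x j = 0) \<longleftrightarrow> dragon E (M i) C" if "i \<in> I" for i
  proof -
    interpret finite_matroid E "M i" by (rule finite_matroidI[OF mat[OF that]])
    have "(\<exists>x\<in>K i. \<forall>j. j \<notin> E \<longrightarrow> x j = 0) \<longleftrightarrow> K i \<noteq> {}"
      using matroid_polytope_support[OF mat[OF that]] by (auto simp: K_def)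
    then show ?thesis
      using matroid_polytope_meets_dragon_polyhedron[OF assms nonempty] by (simp add: K_def)
  qed
  ultimately show ?thesis by simp
qed simp

text \<open>The signs and the index set in \<open>x_op\<close> depend only on \<open>E\<close> and
  \<open>S\<close>, so the relation passes through each variable; supersets of a nonempty
  \<open>S\<close> within \<open>E\<close> keep \<open>C\<close> admissible.\<close>

lemma monomial_value_relation:
  assumes "{} \<notin># X" "{} \<notin># C" "\<And>A. A \<in># C \<Longrightarrow> A \<subseteq> E"
  shows "(\<Sum>i\<in>I. a i * monomial_value E (M i) X C) = 0"
  using assms
proof (induction X arbitrary: C)
  case empty
  have "(\<Sum>i\<in>I. a i * monomial_value E (M i) {#} C) =
      of_int (\<Sum>i\<in>I. a i * of_bool (dragon E (M i) C))"
    by (simp add: monomial_value_empty)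
  then show ?case using dragon_relation[OF empty.prems(2,3)] by simp
next
  case (add S X)
  have "(\<Sum>i\<in>I. a i * monomial_value E (M i) (add_mset S X) C) =
      - (\<Sum>i\<in>I. \<Sum>A | S \<subseteq> A \<and> A \<subseteq> E. (-1) ^ card (A - S) * (a i * monomial_value E (M i) X (add_mset A C)))"
    by (simp add: monomial_value_add x_op_def sum_distrib_left sum_negf mult.left_commute)
  also have "\<dots> = - (\<Sum>A | S \<subseteq> A \<and> A \<subseteq> E. (-1) ^ card (A - S) *
      (\<Sum>i\<in>I. a i * monomial_value E (M i) X (add_mset A C)))"
    by (subst sum.swap) (simp add: sum_distrib_left)
  also have "\<dots> = 0"
  proof -
    have "(\<Sum>i\<in>I. a i * monomial_value E (M i) X (add_mset A C)) = 0" if "S \<subseteq> A" "A \<subseteq> E" for A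
      by (rule add.IH) (use add.prems that in auto)
    then show ?thesis by simp
  qed
  finally show ?case .
qed

lemma poly_value_relation:
  assumes "p \<in> polys {S. S \<noteq> {} \<and> S \<subset> E}"
  shows "(\<Sum>i\<in>I. a i * poly_value E (M i) p) = 0"
proof -
  have "(\<Sum>i\<in>I. a i * poly_value E (M i) p) = (\<Sum>m\<in>Poly_Mapping.keys p.
      Poly_Mapping.lookup p m * (\<Sum>i\<in>I. a i * monomial_value E (M i) (monomial_mset m) {#}))"
    unfolding poly_value_def sum_distrib_left by (subst sum.swap) (simp add: mult.left_commute)
  also have "\<dots> = 0"
  proof (rule sum.neutral, rule ballI)
    fix m assume "m \<in> Poly_Mapping.keys p"
    then have "Poly_Mapping.keys m \<subseteq> {S. S \<noteq> {} \<and> S \<subset> E}" using assms by (simp add: polys_iff)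
    then have "{} \<notin># monomial_mset m" by auto
    then show "Poly_Mapping.lookup p m *
        (\<Sum>i\<in>I. a i * monomial_value E (M i) (monomial_mset m) {#}) = 0"
      using monomial_value_relation[of "monomial_mset m" "{#}"] by simp
  qed
  finally show ?thesis .
qed

end

section \<open>Hypersimplex classes as polynomials\<close>

definition hypersimplex_coeff :: "'a set \<Rightarrow> nat \<Rightarrow> 'a set \<Rightarrow> real" where
  "hypersimplex_coeff E k S = real (min (card S) k) - real k / real (card E) * real (card S)"

text \<open>Variables of all subsets occur, so that the polynomial does not depend on a
  matroid.\<close>

definition hypersimplex_poly :: "'a set \<Rightarrow> nat \<Rightarrow> 'a set rpoly" where
  "hypersimplex_poly E k =
     (\<Sum>S | S \<noteq> {} \<and> S \<subset> E. poly_const (hypersimplex_coeff E k S) * poly_var S)"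

lemma hypersimplex_poly_polys: "hypersimplex_poly E k \<in> polys {S. S \<noteq> {} \<and> S \<subset> E}"
  unfolding hypersimplex_poly_def by (intro polys_sum polys_mult polys_const polys_var)

context finite_matroid
begin

text \<open>Variables of nonflats are replaced by zero, as in \<open>chow_x\<close>, to land in the
  ring whose quotient is the Chow ring.\<close>

definition hypersimplex_flat_poly :: "nat \<Rightarrow> 'a set rpoly" where
  "hypersimplex_flat_poly k = (\<Sum>S\<in>subset_vars.
     poly_const (hypersimplex_coeff E k S) * (if S \<in> proper_flats E M then poly_var S else 0))"

lemma hypersimplex_flat_poly_polys: "hypersimplex_flat_poly k \<in> polys (proper_flats E M)"
  unfolding hypersimplex_flat_poly_def
  by (intro polys_sum polys_mult polys_const) (simp add: polys_var)

lemma homogeneous_hypersimplex_flat_poly: "homogeneous 1 (hypersimplex_flat_poly k)"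
  unfolding hypersimplex_flat_poly_def
proof (rule homogeneous_sum)
  fix S
  have "homogeneous 1 (if S \<in> proper_flats E M then poly_var S else 0)"
    using homogeneous_var[of S] by simp
  from homogeneous_mult[OF homogeneous_const this]
  show "homogeneous 1 (poly_const (hypersimplex_coeff E k S) *
      (if S \<in> proper_flats E M then poly_var S else 0))" by simp
qed

lemma hypersimplex_class_eq: "hypersimplex_class E M k = chow_class E M (hypersimplex_flat_poly k)"
  unfolding hypersimplex_class_def hypersimplex_flat_poly_def
proof (rule finsum_chow_class)
  fix S
  have x: "(if S \<in> proper_flats E M then poly_var S else 0) \<in> polys (proper_flats E M)"
    by (simp add: polys_var)
  then show "poly_const (hypersimplex_coeff E k S) * (if S \<in> proper_flats E M then poly_var S else 0)
      \<in> polys (proper_flats E M)"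
    by (rule polys_mult[OF polys_const])
  show "chow_smult E M (real (min (card S) k) - real k / real (card E) * real (card S)) (chow_x E M S) =
      chow_class E M (poly_const (hypersimplex_coeff E k S) * (if S \<in> proper_flats E M then poly_var S else 0))"
    unfolding chow_x_class chow_smult_class[OF x] hypersimplex_coeff_def ..
qed

lemma hypersimplex_poly_diff_null: "null_poly (hypersimplex_poly E k - hypersimplex_flat_poly k)"
proof -
  have "hypersimplex_poly E k - hypersimplex_flat_poly k = (\<Sum>S\<in>subset_vars.
      poly_const (hypersimplex_coeff E k S) * (if S \<in> proper_flats E M then 0 else poly_var S))"
    unfolding hypersimplex_poly_def hypersimplex_flat_poly_def sum_subtractf[symmetric]
    by (rule sum.cong) auto
  also have "null_poly \<dots>"
    by (intro null_poly_sum null_poly_mult polys_const) (simp add: null_poly_zero null_poly_nonflat)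
  finally show ?thesis .
qed

text \<open>The degree is computed with the flat polynomials, which represent the classes, and then
  transferred to the matroid-independent polynomial modulo null polynomials.\<close>

lemma chow_deg_hypersimplex:
  assumes "loopless E M" "rk E = r + 1" "finite K" "(\<Sum>k\<in>K. c k) = r"
  shows "chow_deg E M
      (finprod (chow_ring E M) (\<lambda>k. hypersimplex_class E M k [^]\<^bsub>chow_ring E M\<^esub> c k) K) =
    poly_value E M (\<Prod>k\<in>K. hypersimplex_poly E k ^ c k)"
proof -
  let ?p = "\<Prod>k\<in>K. hypersimplex_flat_poly k ^ c k"
  have "finprod (chow_ring E M) (\<lambda>k. hypersimplex_class E M k [^]\<^bsub>chow_ring E M\<^esub> c k) K =
      chow_class E M ?p"
    by (rule finprod_chow_class)
      (simp_all add: polys_power hypersimplex_flat_poly_polys hypersimplex_class_eq chow_class_power)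
  moreover have "?p \<in> polys (proper_flats E M)"
    by (intro polys_prod polys_power hypersimplex_flat_poly_polys)
  moreover have "homogeneous (\<Sum>k\<in>K. c k * 1) ?p"
    by (intro homogeneous_prod homogeneous_power homogeneous_hypersimplex_flat_poly assms(3))
  then have "homogeneous r ?p" using assms(4) by simp
  ultimately have "chow_deg E M
      (finprod (chow_ring E M) (\<lambda>k. hypersimplex_class E M k [^]\<^bsub>chow_ring E M\<^esub> c k) K) =
      poly_value E M ?p"
    using chow_deg_class[OF assms(1,2)] by simp
  also have "\<dots> = poly_value E M (\<Prod>k\<in>K. hypersimplex_poly E k ^ c k)"
  proof -
    have flat: "hypersimplex_flat_poly k \<in> polys subset_vars" for k
      using hypersimplex_flat_poly_polys polys_mono[OF proper_flats_subset_vars] by blast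
    have "null_poly ((\<Prod>k\<in>K. hypersimplex_poly E k ^ c k) - ?p)"
      by (intro null_poly_diff_prod null_poly_diff_power hypersimplex_poly_diff_null
          polys_power hypersimplex_poly_polys flat)
    then show ?thesis using null_poly_value poly_value_diff by (metis eq_iff_diff_eq_0)
  qed
  finally show ?thesis .
qed

lemma poly_value_not_loopless: "\<not> loopless E M \<Longrightarrow> poly_value E M p = 0"
  by (simp add: poly_value_def monomial_value_not_loopless)

end

theorem theorem6p6:
  fixes n r :: nat and c :: "nat \<Rightarrow> nat" and E :: "nat set"
  assumes "E = {0..n}"
    and "(\<Sum>k=1..n. c k) = r"
  shows "valuative_on {M. matroid E M \<and> mrank M E = r + 1}
    (\<lambda>M. if loopless E M
         then chow_deg E M
           (finprod (chow_ring E M)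
              (\<lambda>k. hypersimplex_class E M k [^]\<^bsub>chow_ring E M\<^esub> c k) {1..n})
         else 0)"
proof -
  \<comment> \<open>One polynomial for all matroids, so that the relation can be applied to its
    values.\<close>
  define p where "p = (\<Prod>k=1..n. hypersimplex_poly E k ^ c k)"
  have p: "p \<in> polys {S. S \<noteq> {} \<and> S \<subset> E}"
    unfolding p_def by (intro polys_prod polys_power hypersimplex_poly_polys)
  have val: "(if loopless E M
         then chow_deg E M
           (finprod (chow_ring E M)
              (\<lambda>k. hypersimplex_class E M k [^]\<^bsub>chow_ring E M\<^esub> c k) {1..n})
         else 0) = poly_value E M p" if "matroid E M" "mrank M E = r + 1" for M
  proof -
    interpret finite_matroid E M by (rule finite_matroidI[OF that(1)])
    \<comment> \<open>With loops both sides are zero: the left by convention, the right because no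
      multiset satisfies the dragon condition.\<close>
    show ?thesis
      using chow_deg_hypersimplex[OF _ that(2) finite_atLeastAtMost assms(2)] poly_value_not_loopless
      by (auto simp: p_def)
  qed
  show ?thesis
    unfolding valuative_on_def
  proof (intro allI impI, elim conjE)
    fix m :: nat and M :: "nat \<Rightarrow> nat set set" and a :: "nat \<Rightarrow> int"
    assume M: "\<forall>i\<in>{1..m}. M i \<in> {M. matroid E M \<and> mrank M E = r + 1}"
      and rel: "\<forall>x. (\<Sum>i=1..m. a i * indicator (matroid_polytope (M i)) x) = 0"
    have "(\<Sum>i=1..m. of_int (a i) * (if loopless E (M i)
         then chow_deg E (M i)
           (finprod (chow_ring E (M i))
              (\<lambda>k. hypersimplex_class E (M i) k [^]\<^bsub>chow_ring E (M i)\<^esub> c k) {1..n})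
         else 0)) = (\<Sum>i=1..m. a i * poly_value E (M i) p)"
      by (rule sum.cong[OF refl]) (use M val in simp)
    also have "\<dots> = 0"
      by (rule poly_value_relation[OF _ _ _ _ p]) (use M rel assms(1) in auto)
    finally show "(\<Sum>i=1..m. of_int (a i) * (if loopless E (M i)
         then chow_deg E (M i)
           (finprod (chow_ring E (M i))
              (\<lambda>k. hypersimplex_class E (M i) k [^]\<^bsub>chow_ring E (M i)\<^esub> c k) {1..n})
         else 0)) = 0" .
  qed
qed

end
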